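(* Assume $F(b^*_{v,F})>0$ and $F$ is unknown to the bidder. For any $\gamma>2$, the regret of UCBid1+ satisfies $$R_T^{v,F}\ \le\ 12\sqrt{\frac{\gamma v}{U_{v,F}(b^*_{v,F})}}\sqrt{T\log T}+O(\log T).$$
   Context: Model: at rounds $t=1,\dots,T$ a bidder submits $B_t\in[0,1]$. $(V_t)$ i.i.d. in $[0,1]$ with mean $v$; $(M_t)$ i.i.d. in $[0,1]$ with CDF $F$, independent of $(V_t)$. If $M_t\le B_t$ the bidder wins, pays $B_t$, receives and observes $V_t$; otherwise she does not observe $V_t$. $M_t$ is observed at the end of every round. $U_{v,F}(b)=(v-b)F(b)$, $b^*_{v,F}=\max\{\operatorname{argmax}_{b\in[0,1]}U_{v,F}(b)\}$, $R_T^{v,F}=T\max_bU_{v,F}(b)-\sum_{t=1}^T\mathbb E[U_{v,F}(B_t)]$. Notation: $N_t=\sum_{s=1}^{t-1}\mathbf 1\{M_s\le B_s\}$, $\hat V_t=\frac1{N_t}\sum_{s=1}^{t-1}V_s\mathbf 1\{M_s\le B_s\}$, $\epsilon_t=\sqrt{\gamma\log(t-1)/(2N_t)}$, $\hat F_t(b)=\frac1{t-1}\sum_{s=1}^{t-1}\mathbf 1\{M_s<b\}$. Algorithm UCBid1+ (parameter $\gamma$): $B_1=1$ and for $t\ge2$, $B_t=\max\{\operatorname{argmax}_{b\in[0,1]}(\hat V_t+\epsilon_t-b)\hat F_t(b)\}$.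
   Formalization: The empirical CDF uses M_s ≤ b instead of M_s < b (with strict inequality the argmax defining B_t is empty whenever its supremum is positive), max argmax is read as a supremum, and U(b* ) > 0 is assumed so that the bound is finite. *)

theory Defs
  imports "HOL-Probability.Probability"
begin

definition util :: "real \<Rightarrow> (real \<Rightarrow> real) \<Rightarrow> real \<Rightarrow> real" where
  "util v F b = (v - b) * F b"

definition bstar :: "real \<Rightarrow> (real \<Rightarrow> real) \<Rightarrow> real" where
  "bstar v F = Sup {b \<in> {0..1}. \<forall>b'\<in>{0..1}. util v F b' \<le> util v F b}"

text \<open>Quantities of UCBid1+ at round t, computed from past bids B, past values vs
  (only used on won rounds) and past highest competing bids m.\<close>
definition Nwins :: "(nat \<Rightarrow> real) \<Rightarrow> (nat \<Rightarrow> real) \<Rightarrow> nat \<Rightarrow> nat" where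
  "Nwins B m t = card {s \<in> {1..<t}. m s \<le> B s}"

definition Vhat :: "(nat \<Rightarrow> real) \<Rightarrow> (nat \<Rightarrow> real) \<Rightarrow> (nat \<Rightarrow> real) \<Rightarrow> nat \<Rightarrow> real" where
  "Vhat B vs m t = (\<Sum>s\<in>{1..<t}. if m s \<le> B s then vs s else 0) / real (Nwins B m t)"

definition epsb :: "real \<Rightarrow> (nat \<Rightarrow> real) \<Rightarrow> (nat \<Rightarrow> real) \<Rightarrow> nat \<Rightarrow> real" where
  "epsb \<gamma> B m t = sqrt (\<gamma> * ln (real t - 1) / (2 * real (Nwins B m t)))"

definition Fhat :: "(nat \<Rightarrow> real) \<Rightarrow> nat \<Rightarrow> real \<Rightarrow> real" where
  "Fhat m t b = real (card {s \<in> {1..<t}. m s \<le> b}) / (real t - 1)"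

definition next_bid :: "real \<Rightarrow> (nat \<Rightarrow> real) \<Rightarrow> (nat \<Rightarrow> real) \<Rightarrow> (nat \<Rightarrow> real) \<Rightarrow> nat \<Rightarrow> real" where
  "next_bid \<gamma> vs m B t =
     (let c = Vhat B vs m t + epsb \<gamma> B m t
      in Sup {b \<in> {0..1}. \<forall>b'\<in>{0..1}. (c - b') * Fhat m t b' \<le> (c - b) * Fhat m t b})"

text \<open>bids \<gamma> vs m n = [B_1, ..., B_n].\<close>
primrec bids :: "real \<Rightarrow> (nat \<Rightarrow> real) \<Rightarrow> (nat \<Rightarrow> real) \<Rightarrow> nat \<Rightarrow> real list" where
  "bids \<gamma> vs m 0 = []"
| "bids \<gamma> vs m (Suc n) =
     (let bs = bids \<gamma> vs m n
      in bs @ [if n = 0 then 1 else next_bid \<gamma> vs m (\<lambda>s. bs ! (s - 1)) (Suc n)])"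

definition ucbid :: "real \<Rightarrow> (nat \<Rightarrow> real) \<Rightarrow> (nat \<Rightarrow> real) \<Rightarrow> nat \<Rightarrow> real" where
  "ucbid \<gamma> vs m t = bids \<gamma> vs m t ! (t - 1)"

end

theory Submission
  imports Defs
begin

text \<open>
  Write \<open>U\<close> for the utility, \<open>b\<close> for its largest maximiser, \<open>p = U(b) / v\<close> and \<open>n = t - 1\<close>. Call
  round \<open>t\<close> good if \<open>v\<close> lies in the confidence interval around the mean of the observed values, the
  empirical distribution function exceeds \<open>F\<close> nowhere by much more than
  \<open>\<delta> n = sqrt (\<gamma> ln n / (2 n))\<close>, and it is not below \<open>F\<close> by more than \<open>\<delta> n\<close> at \<open>b\<close>. Exponential
  supermartingales and a union bound over the number of wins show that a round is bad with
  probability \<open>O(n powr (1 - \<gamma>))\<close>, which is summable because \<open>\<gamma> > 2\<close>.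

  In a good round, comparing the bid with \<open>b\<close> in the optimistic objective bounds the regret by a
  multiple of \<open>\<delta> n\<close> plus twice the confidence radius, and it also shows that the probability of
  winning is at least \<open>p - O(\<delta> n)\<close>. Hence the number of wins is at least \<open>p n / 4\<close>, outside an event
  of probability \<open>O(1 / n)\<close>, and the radius is \<open>O(sqrt (\<gamma> ln n / (p n)))\<close>. Summing over the rounds,
  the main terms give \<open>12 sqrt (\<gamma> / p) sqrt (T ln T)\<close> and the exceptional events give \<open>O(ln T)\<close>.
\<close>

subsection \<open>The bids as functionals of the past\<close>

lemma length_bids [simp]: "length (bids \<gamma> vs m n) = n"
  by (induction n) (simp_all add: Let_def)

lemma bids_nth: "s < n \<Longrightarrow> bids \<gamma> vs m n ! s = ucbid \<gamma> vs m (Suc s)"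
proof (induction n)
  case (Suc n)
  then show ?case
    by (cases "s = n") (auto simp: ucbid_def nth_append Let_def)
qed simp

lemma ucbid_1: "ucbid \<gamma> vs m (Suc 0) = 1"
  by (simp add: ucbid_def Let_def)

lemma Nwins_cong: "(\<And>s. s \<in> {1..<t} \<Longrightarrow> B s = B' s) \<Longrightarrow> (\<And>s. s \<in> {1..<t} \<Longrightarrow> m s = m' s) \<Longrightarrow>
    Nwins B m t = Nwins B' m' t"
  unfolding Nwins_def by (rule arg_cong[where f = card]) auto

lemma Vhat_cong: "(\<And>s. s \<in> {1..<t} \<Longrightarrow> B s = B' s) \<Longrightarrow> (\<And>s. s \<in> {1..<t} \<Longrightarrow> vs s = vs' s) \<Longrightarrow>
    (\<And>s. s \<in> {1..<t} \<Longrightarrow> m s = m' s) \<Longrightarrow> Vhat B vs m t = Vhat B' vs' m' t"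
  unfolding Vhat_def using Nwins_cong[of t B B' m m']
  by (auto intro!: arg_cong2[where f = "(/)"] sum.cong)

lemma Fhat_cong: "(\<And>s. s \<in> {1..<t} \<Longrightarrow> m s = m' s) \<Longrightarrow> Fhat m t = Fhat m' t"
  unfolding Fhat_def
  by (intro ext arg_cong2[where f = "(/)"] arg_cong[where f = real] arg_cong[where f = card]) auto

lemma next_bid_cong:
  assumes "\<And>s. s \<in> {1..<t} \<Longrightarrow> B s = B' s" "\<And>s. s \<in> {1..<t} \<Longrightarrow> vs s = vs' s"
    "\<And>s. s \<in> {1..<t} \<Longrightarrow> m s = m' s"
  shows "next_bid \<gamma> vs m B t = next_bid \<gamma> vs' m' B' t"
  using Nwins_cong[of t B B' m m'] Vhat_cong[of t B B' vs vs' m m'] Fhat_cong[of t m m'] assms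
  unfolding next_bid_def epsb_def by simp

text \<open>The list of bids only serves primitive recursion. The next bid looks at earlier rounds
  alone, so the list lookup can be replaced by the bid function itself.\<close>

lemma ucbid_rec:
  assumes "t \<ge> 2"
  shows "ucbid \<gamma> vs m t = next_bid \<gamma> vs m (ucbid \<gamma> vs m) t"
proof -
  obtain n where n: "t = Suc n" "n \<ge> 1" using assms by (cases t) auto
  have "ucbid \<gamma> vs m t = next_bid \<gamma> vs m (\<lambda>s. bids \<gamma> vs m n ! (s - 1)) t"
    using n by (simp add: ucbid_def Let_def nth_append)
  also have "\<dots> = next_bid \<gamma> vs m (ucbid \<gamma> vs m) t"
    using n by (intro next_bid_cong) (auto simp: bids_nth)
  finally show ?thesis .
qed

text \<open>Non-anticipation, by strong induction on the round. It is what later allows a bid to be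
  held fixed while the data of its own round are integrated.\<close>

lemma ucbid_cong:
  assumes "\<And>s. s \<in> {1..<t} \<Longrightarrow> vs s = vs' s" "\<And>s. s \<in> {1..<t} \<Longrightarrow> m s = m' s" "t \<ge> 1"
  shows "ucbid \<gamma> vs m t = ucbid \<gamma> vs' m' t"
  using assms
proof (induction t rule: less_induct)
  case (less t)
  show ?case
  proof (cases "t = 1")
    case True
    then show ?thesis by (simp add: ucbid_1)
  next
    case False
    with less.prems have t: "t \<ge> 2" by simp
    show ?thesis unfolding ucbid_rec[OF t]
      by (intro next_bid_cong less.IH less.prems) (use less.prems in auto)
  qed
qed

section \<open>Maximisers of a decreasing factor times an empirical distribution function\<close>

lemma real_card_eq_sum: "finite A \<Longrightarrow> real (card {s \<in> A. Q s}) = (\<Sum>s\<in>A. if Q s then 1 else 0)"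
  by (simp add: sum.If_cases Int_def)

text \<open>Between two consecutive points \<open>m s\<close> the objective is decreasing as long as it is positive, so
  a positive maximum is attained at some \<open>m s\<close>. Otherwise the objective is maximal exactly where
  the empirical distribution function vanishes (up to its first jump), and the supremum is that
  jump, which need not be a maximiser.\<close>

lemma Sup_argmax_step:
  fixes m :: "'i \<Rightarrow> real" and c n :: real
  assumes S: "finite S" "S \<noteq> {}" and m01: "\<And>s. s \<in> S \<Longrightarrow> m s \<in> {0..1}"
    and c: "c \<ge> 0" and n: "n > 0"
  defines "g \<equiv> \<lambda>b. (c - b) * (real (card {s \<in> S. m s \<le> b}) / n)"
  defines "B \<equiv> Sup {b \<in> {0..1}. \<forall>b'\<in>{0..1}. g b' \<le> g b}"
  shows Sup_argmax_step_pos: "\<exists>s\<in>S. g (m s) > 0 \<Longrightarrow>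
          B \<in> {m s |s. s \<in> S \<and> (\<forall>r\<in>S. g (m r) \<le> g (m s))} \<and> (\<forall>b\<in>{0..1}. g b \<le> g B) \<and>
          (\<forall>s\<in>S. (\<forall>r\<in>S. g (m r) \<le> g (m s)) \<longrightarrow> m s \<le> B)"
    and Sup_argmax_step_nonpos: "\<not> (\<exists>s\<in>S. g (m s) > 0) \<Longrightarrow> B = Min (m ` S)"
    and step_obj_pos_at_jump: "\<And>b. g b > 0 \<Longrightarrow> \<exists>s\<in>S. g (m s) > 0"
proof -
  \<comment> \<open>The witness is the largest jump not exceeding \<open>b\<close>: no further jump
    lies between the two points, so the counts agree.\<close>
  have jump: "\<exists>s\<in>S. m s \<le> b \<and> {r \<in> S. m r \<le> b} = {r \<in> S. m r \<le> m s}"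
    if "{r \<in> S. m r \<le> b} \<noteq> {}" for b
  proof -
    let ?R = "{r \<in> S. m r \<le> b}"
    have "finite (m ` ?R)" "m ` ?R \<noteq> {}" using S that by auto
    then have "Max (m ` ?R) \<in> m ` ?R" and le: "\<And>r. r \<in> ?R \<Longrightarrow> m r \<le> Max (m ` ?R)"
      using Max_in by auto
    then obtain s where "s \<in> ?R" "Max (m ` ?R) = m s" by auto
    with le show ?thesis by (intro bexI[of _ s]) force+
  qed
  have cardpos: "card {r \<in> S. m r \<le> b} > 0" if "{r \<in> S. m r \<le> b} \<noteq> {}" for b
    using that S by (simp add: card_gt_0_iff)
  \<comment> \<open>The count is unchanged and positive, while moving left to that jump raises
    \<open>c - b\<close>. A nonzero value of \<open>g\<close> is therefore dominated by its value at
    a jump, strictly unless \<open>b\<close> is that jump.\<close>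
  have dom: "g b = 0 \<or> (\<exists>s\<in>S. m s \<le> b \<and> g b \<le> g (m s) \<and> (m s < b \<longrightarrow> g b < g (m s)))" for b
  proof (cases "{r \<in> S. m r \<le> b} = {}")
    case False
    from jump[OF this] obtain s where s: "s \<in> S" "m s \<le> b" "{r \<in> S. m r \<le> b} = {r \<in> S. m r \<le> m s}"
      by blast
    have "real (card {r \<in> S. m r \<le> m s}) / n > 0" using cardpos[OF False] s n by simp
    then have "g b \<le> g (m s) \<and> (m s < b \<longrightarrow> g b < g (m s))"
      unfolding g_def s(3) using s(2)
      by (intro conjI impI mult_right_mono mult_strict_right_mono) simp_all
    with s show ?thesis by blast
  next
    case True then have "g b = 0" unfolding g_def by (simp add: True)
    then show ?thesis ..
  qed
  show "\<exists>s\<in>S. g (m s) > 0" if "g b > 0" for b using dom[of b] that by force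
  {
    assume ex: "\<exists>s\<in>S. g (m s) > 0"
    let ?A = "Max ((\<lambda>s. g (m s)) ` S)"
    let ?X = "{m s |s. s \<in> S \<and> (\<forall>r\<in>S. g (m r) \<le> g (m s))}"
    have leA: "g (m s) \<le> ?A" if "s \<in> S" for s using that S by simp
    from ex leA have A0: "?A > 0" by force
    have "?A \<in> (\<lambda>s. g (m s)) ` S" using S by (intro Max_in) auto
    then obtain s0 where s0: "s0 \<in> S" "g (m s0) = ?A" by auto
    have gA: "g b \<le> ?A" for b using dom[of b] leA A0 by force
    have X: "?X = {m s |s. s \<in> S \<and> g (m s) = ?A}"
      using s0 leA by (force intro: antisym)
    have eq: "{b \<in> {0..1}. \<forall>b'\<in>{0..1}. g b' \<le> g b} = ?X"
    proof safe
      fix b assume b: "b \<in> {0..1}" "\<forall>b'\<in>{0..1}. g b' \<le> g b"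
      then have gb: "g b = ?A" using s0 m01[of s0] gA[of b] by fastforce
      then obtain s where s: "s \<in> S" "m s \<le> b" "g b \<le> g (m s)" "m s < b \<longrightarrow> g b < g (m s)"
        using dom[of b] A0 by auto
      then have "m s = b" using gA[of "m s"] gb by fastforce
      with s gb show "\<exists>s. b = m s \<and> s \<in> S \<and> (\<forall>r\<in>S. g (m r) \<le> g (m s))" 
        using leA by (intro exI[of _ s]) auto
    next
      fix s b' assume "s \<in> S" "\<forall>r\<in>S. g (m r) \<le> g (m s)"
      then show "g b' \<le> g (m s)" using gA[of b'] s0 by fastforce
    qed (use m01 in auto)
    have fin: "finite ?X" using S by auto
    have ne: "?X \<noteq> {}" unfolding X using s0 by blast
    have "B = Max ?X" unfolding B_def eq using fin ne by (rule cSup_eq_Max)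
    then have BX: "B \<in> ?X" and "\<And>x. x \<in> ?X \<Longrightarrow> x \<le> B" using fin ne Max_in[of ?X] by simp_all
    moreover have "g B = ?A" using BX unfolding X by auto
    ultimately show "B \<in> ?X \<and> (\<forall>b\<in>{0..1}. g b \<le> g B) \<and>
          (\<forall>s\<in>S. (\<forall>r\<in>S. g (m r) \<le> g (m s)) \<longrightarrow> m s \<le> B)" using gA by auto
  }
  {
    assume nex: "\<not> (\<exists>s\<in>S. g (m s) > 0)"
    let ?\<mu> = "Min (m ` S)"
    have "?\<mu> \<in> m ` S" using S by (intro Min_in) auto
    then obtain s1 where s1: "s1 \<in> S" "m s1 = ?\<mu>" by auto
    have le\<mu>: "?\<mu> \<le> m s" if "s \<in> S" for s using that S by simp
    have ne: "{r \<in> S. m r \<le> b} \<noteq> {}" if "b \<ge> ?\<mu>" for b using s1 that by fastforce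
    have "(c - ?\<mu>) * (real (card {s \<in> S. m s \<le> ?\<mu>}) / n) \<le> 0"
      using nex s1 unfolding g_def by force
    moreover have "real (card {s \<in> S. m s \<le> ?\<mu>}) / n > 0" using cardpos[OF ne[of ?\<mu>]] n by simp
    \<comment> \<open>The count at the first jump is positive, so a nonpositive objective there must
      come from the factor \<open>c - ?\<mu>\<close>.\<close>
    ultimately have c\<mu>: "c \<le> ?\<mu>" by (meson not_less diff_gt_0_iff_gt mult_pos_pos)
    have below: "g b = 0" if "b < ?\<mu>" for b
    proof -
      have *: "{s \<in> S. m s \<le> b} = {}" using le\<mu> that by fastforce
      show ?thesis unfolding g_def * by simp
    qed
    have above: "g b < 0" if "b > ?\<mu>" for b
    proof -
      have "real (card {s \<in> S. m s \<le> b}) / n > 0" using cardpos[of b] ne[of b] that n by simp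
      then show ?thesis unfolding g_def using that c\<mu> by (intro mult_neg_pos) auto
    qed
    have \<mu>01: "?\<mu> \<in> {0..1}" using m01[OF s1(1)] s1 by simp
    have g0: "g 0 = 0"
    proof (cases "?\<mu> = 0")
      case True then show ?thesis using c\<mu> c by (simp add: g_def)
    next
      case False then show ?thesis using \<mu>01 by (intro below) auto
    qed
    have le0: "g b \<le> 0" for b
    proof -
      consider "b < ?\<mu>" | "b = ?\<mu>" | "b > ?\<mu>" by linarith
      then show ?thesis
        using below[of b] above[of b] nex s1 by cases force+
    qed
    show "B = ?\<mu>" unfolding B_def
    proof (cases "?\<mu> = 0")
      case True
      have "{b \<in> {0..1}. \<forall>b'\<in>{0..1}. g b' \<le> g b} = {0}"
      proof safe
        fix b assume "b \<in> {0..1::real}" "\<forall>b'\<in>{0..1}. g b' \<le> g b"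
        then have "g 0 \<le> g b" by simp
        then have "g b \<ge> 0" using g0 by simp
        then have "\<not> b > 0" using above[of b] True by auto
        with \<open>b \<in> {0..1}\<close> show "b = 0" by simp
      qed (use le0 g0 in auto)
      then show "Sup {b \<in> {0..1}. \<forall>b'\<in>{0..1}. g b' \<le> g b} = ?\<mu>" using True by simp
    next
      case False
      then have pos: "?\<mu> > 0" using \<mu>01 by simp
      \<comment> \<open>The maximum 0 is taken everywhere below \<open>?\<mu>\<close> and nowhere
        above it; the supremum is \<open>?\<mu>\<close> whether or not it is a maximiser
        itself.\<close>
      show "Sup {b \<in> {0..1}. \<forall>b'\<in>{0..1}. g b' \<le> g b} = ?\<mu>"
      proof (rule cSup_eq)
        fix x assume "x \<in> {b \<in> {0..1}. \<forall>b'\<in>{0..1}. g b' \<le> g b}"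
        then have "g 0 \<le> g x" by simp
        then have "g x \<ge> 0" using g0 by simp
        then show "x \<le> ?\<mu>" using above[of x] by force
      next
        fix y assume y: "\<And>x. x \<in> {b \<in> {0..1}. \<forall>b'\<in>{0..1}. g b' \<le> g b} \<Longrightarrow> x \<le> y"
        show "?\<mu> \<le> y"
        proof (rule dense_le_bounded[OF pos])
          fix w assume "0 < w" "w < ?\<mu>"
          then show "w \<le> y" using le0 below \<mu>01 by (intro y) auto
        qed
      qed
    qed
  }
qed

definition ucb_index :: "real \<Rightarrow> (nat \<Rightarrow> real) \<Rightarrow> (nat \<Rightarrow> real) \<Rightarrow> nat \<Rightarrow> real" where
  "ucb_index \<gamma> vs m t = Vhat (ucbid \<gamma> vs m) vs m t + epsb \<gamma> (ucbid \<gamma> vs m) m t"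

definition ucb_obj :: "real \<Rightarrow> (nat \<Rightarrow> real) \<Rightarrow> (nat \<Rightarrow> real) \<Rightarrow> nat \<Rightarrow> real \<Rightarrow> real" where
  "ucb_obj \<gamma> vs m t b = (ucb_index \<gamma> vs m t - b) * Fhat m t b"

lemma epsb_nonneg: "\<gamma> \<ge> 0 \<Longrightarrow> t \<ge> 2 \<Longrightarrow> epsb \<gamma> B m t \<ge> 0"
  unfolding epsb_def by (auto intro!: divide_nonneg_nonneg mult_nonneg_nonneg)

lemma ucb_index_nonneg:
  assumes "\<gamma> \<ge> 0" "t \<ge> 2" "\<And>s. s \<in> {1..<t} \<Longrightarrow> vs s \<in> {0..1}"
  shows "ucb_index \<gamma> vs m t \<ge> 0"
  unfolding ucb_index_def Vhat_def
  using epsb_nonneg[OF assms(1,2)] assms(3)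
  by (auto intro!: add_nonneg_nonneg divide_nonneg_nonneg sum_nonneg)

context
  fixes \<gamma> :: real and vs m :: "nat \<Rightarrow> real" and t :: nat
  assumes g0: "\<gamma> \<ge> 0" and t2: "t \<ge> 2"
    and vs01: "\<And>s. s \<in> {1..<t} \<Longrightarrow> vs s \<in> {0..1}" and m01: "\<And>s. s \<in> {1..<t} \<Longrightarrow> m s \<in> {0..1}"
begin

private lemma ucbid_eq_Sup:
  "ucbid \<gamma> vs m t = Sup {b \<in> {0..1}. \<forall>b'\<in>{0..1}. ucb_obj \<gamma> vs m t b' \<le> ucb_obj \<gamma> vs m t b}"
  unfolding ucbid_rec[OF t2] next_bid_def ucb_obj_def ucb_index_def Let_def ..

private lemmas step = Sup_argmax_step[of "{1..<t}" m "ucb_index \<gamma> vs m t" "real t - 1",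
    folded Fhat_def, folded ucb_obj_def, folded ucbid_eq_Sup]

private lemma step_prems: "finite {1..<t}" "{1..<t} \<noteq> {}" "0 \<le> ucb_index \<gamma> vs m t" "0 < real t - 1"
  using t2 ucb_index_nonneg[OF g0 t2 vs01] by auto

text \<open>Sublevel sets of the bid become finite Boolean combinations of comparisons at the jumps.
  This yields measurability without a measurable selection argument.\<close>

lemma ucbid_le_iff:
  "ucbid \<gamma> vs m t \<le> a \<longleftrightarrow>
    (if \<exists>s\<in>{1..<t}. ucb_obj \<gamma> vs m t (m s) > 0
     then \<forall>s\<in>{1..<t}. (\<forall>r\<in>{1..<t}. ucb_obj \<gamma> vs m t (m r) \<le> ucb_obj \<gamma> vs m t (m s)) \<longrightarrow> m s \<le> a
     else \<exists>s\<in>{1..<t}. m s \<le> a)"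
proof (cases "\<exists>s\<in>{1..<t}. ucb_obj \<gamma> vs m t (m s) > 0")
  case True
  from step(1)[OF step_prems(1,2) m01 step_prems(3,4) True] show ?thesis
    using True by auto
next
  case False
  from step(2)[OF step_prems(1,2) m01 step_prems(3,4) False] show ?thesis
    using False step_prems(1,2) by (simp add: Min_le_iff)
qed

lemma ucbid_in_range_m: "ucbid \<gamma> vs m t \<in> m ` {1..<t}"
proof (cases "\<exists>s\<in>{1..<t}. ucb_obj \<gamma> vs m t (m s) > 0")
  case True
  from step(1)[OF step_prems(1,2) m01 step_prems(3,4) True] show ?thesis by auto
next
  case False
  from step(2)[OF step_prems(1,2) m01 step_prems(3,4) False] show ?thesis
    using Min_in[of "m ` {1..<t}"] step_prems(1,2) by simp
qed

text \<open>A positive value somewhere puts the objective in the case where the supremum of the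
  maximisers is one of the jumps and is itself a maximiser.\<close>

lemma ucbid_optimal:
  assumes "ucb_obj \<gamma> vs m t b0 > 0" "b \<in> {0..1}"
  shows "ucb_obj \<gamma> vs m t b \<le> ucb_obj \<gamma> vs m t (ucbid \<gamma> vs m t)"
  using step(1)[OF step_prems(1,2) m01 step_prems(3,4)]
    step(3)[OF step_prems(1,2) m01 step_prems(3,4) assms(1)] assms(2) by blast

end

lemma ucbid_in_01:
  assumes "\<gamma> \<ge> 0" "t \<ge> 1" "\<And>s. s \<in> {1..<t} \<Longrightarrow> vs s \<in> {0..1}" "\<And>s. s \<in> {1..<t} \<Longrightarrow> m s \<in> {0..1}"
  shows "ucbid \<gamma> vs m t \<in> {0..1}"
proof (cases "t = 1")
  case True
  then show ?thesis by (simp add: ucbid_1)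
next
  case False
  then show ?thesis using ucbid_in_range_m[of \<gamma> t vs m] assms by fastforce
qed

section \<open>Measurability of the bids\<close>

lemma Nwins_eq_sum: "real (Nwins B m t) = (\<Sum>s\<in>{1..<t}. if m s \<le> B s then 1 else 0)"
  unfolding Nwins_def by (rule real_card_eq_sum) simp

lemma Fhat_eq_sum: "Fhat m t b = (\<Sum>s\<in>{1..<t}. if m s \<le> b then 1 else 0) / (real t - 1)"
  unfolding Fhat_def by (subst real_card_eq_sum) simp_all

lemma ucb_index_measurable:
  fixes vs m :: "nat \<Rightarrow> 'b \<Rightarrow> real"
  assumes [measurable]: "\<And>s. s \<in> {1..<t} \<Longrightarrow> vs s \<in> borel_measurable N"
    "\<And>s. s \<in> {1..<t} \<Longrightarrow> m s \<in> borel_measurable N"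
    "\<And>s. s \<in> {1..<t} \<Longrightarrow> (\<lambda>x. ucbid \<gamma> (\<lambda>s. vs s x) (\<lambda>s. m s x) s) \<in> borel_measurable N"
  shows "(\<lambda>x. ucb_index \<gamma> (\<lambda>s. vs s x) (\<lambda>s. m s x) t) \<in> borel_measurable N"
  unfolding ucb_index_def Vhat_def epsb_def Nwins_eq_sum by measurable

text \<open>The domain is arbitrary because the lemma is applied both on the probability space and
  on a product space of past coordinates. By strong induction the earlier bids, and with them the
  index, are measurable; \<open>ucbid_le_iff\<close> then handles the current bid.\<close>

lemma ucbid_measurable:
  fixes vs m :: "nat \<Rightarrow> 'b \<Rightarrow> real"
  assumes "\<gamma> \<ge> 0" "t \<ge> 1"
    and "\<And>s. s \<in> {1..<t} \<Longrightarrow> vs s \<in> borel_measurable N" "\<And>s. s \<in> {1..<t} \<Longrightarrow> m s \<in> borel_measurable N"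
    and "\<And>s x. s \<in> {1..<t} \<Longrightarrow> x \<in> space N \<Longrightarrow> vs s x \<in> {0..1}"
    and "\<And>s x. s \<in> {1..<t} \<Longrightarrow> x \<in> space N \<Longrightarrow> m s x \<in> {0..1}"
  shows "(\<lambda>x. ucbid \<gamma> (\<lambda>s. vs s x) (\<lambda>s. m s x) t) \<in> borel_measurable N"
  using assms
proof (induction t rule: less_induct)
  case (less t)
  show ?case
  proof (cases "t = 1")
    case True
    then show ?thesis by (simp add: ucbid_1)
  next
    case False
    with less.prems have t: "t \<ge> 2" by simp
    note m[measurable] = less.prems(4)
    have "(\<lambda>x. ucbid \<gamma> (\<lambda>s. vs s x) (\<lambda>s. m s x) s) \<in> borel_measurable N" if "s \<in> {1..<t}" for s
      using that by (intro less.IH less.prems) auto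
    then have [measurable]: "(\<lambda>x. ucb_index \<gamma> (\<lambda>s. vs s x) (\<lambda>s. m s x) t) \<in> borel_measurable N"
      by (intro ucb_index_measurable less.prems) 
    define g where "g s x = ucb_obj \<gamma> (\<lambda>s. vs s x) (\<lambda>s. m s x) t (m s x)" for s x
    have g[measurable]: "g s \<in> borel_measurable N" if s[measurable]: "s \<in> {1..<t}" for s
      unfolding g_def ucb_obj_def Fhat_eq_sum by measurable
    show ?thesis
    proof (subst borel_measurable_iff_le, rule allI)
      fix a :: real
      have "{x \<in> space N. ucbid \<gamma> (\<lambda>s. vs s x) (\<lambda>s. m s x) t \<le> a} =
        {x \<in> space N. if \<exists>s\<in>{1..<t}. g s x > 0
          then \<forall>s\<in>{1..<t}. (\<forall>r\<in>{1..<t}. g r x \<le> g s x) \<longrightarrow> m s x \<le> a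
          else \<exists>s\<in>{1..<t}. m s x \<le> a}"
        unfolding g_def using less.prems t by (intro Collect_cong conj_cong refl ucbid_le_iff) auto
      also have "\<dots> \<in> sets N" by measurable
      finally show "{x \<in> space N. ucbid \<gamma> (\<lambda>s. vs s x) (\<lambda>s. m s x) t \<le> a} \<in> sets N" .
    qed
  qed
qed

subsection \<open>Maximisers of the utility and the distribution function\<close>

text \<open>From the right this is right continuity of \<open>F\<close>. From the left, monotonicity
  bounds the utility by the continuous function \<open>(v - y) * F x\<close> as long as
  \<open>y \<le> v\<close>; beyond \<open>v\<close> the utility is nonpositive, hence below the
  positive level \<open>a\<close>.\<close>

lemma util_upper_semicontinuous:
  assumes mono: "mono F" and rc: "continuous (at_right x) F" and nonneg: "\<And>b. F b \<ge> 0"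
    and a: "a > 0" "util v F x < a"
  shows "eventually (\<lambda>y. util v F y < a) (nhds x)"
proof -
  have "((\<lambda>y. util v F y) \<longlongrightarrow> util v F x) (at_right x)"
    unfolding util_def using rc by (auto intro!: tendsto_intros simp: continuous_within)
  then have right: "eventually (\<lambda>y. util v F y < a) (at_right x)"
    using a by (auto dest: order_tendstoD)
  have "((\<lambda>y. (v - y) * F x) \<longlongrightarrow> (v - x) * F x) (at_left x)"
    by (intro tendsto_intros)
  then have "eventually (\<lambda>y. (v - y) * F x < a) (at_left x)"
    using a unfolding util_def by (auto dest: order_tendstoD)
  moreover have "eventually (\<lambda>y. y < x) (at_left x)"
    by (simp add: eventually_at_filter)
  ultimately have left: "eventually (\<lambda>y. util v F y < a) (at_left x)"
  proof eventually_elim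
    case (elim y)
    show ?case
    proof (cases "y \<le> v")
      case True
      then have "util v F y \<le> (v - y) * F x"
        unfolding util_def using elim monoD[OF mono, of y x] by (intro mult_left_mono) auto
      with elim show ?thesis by simp
    next
      case False
      then have "util v F y \<le> 0" unfolding util_def using nonneg[of y] by (simp add: mult_nonpos_nonneg)
      with a show ?thesis by simp
    qed
  qed
  from left right a(2) show ?thesis
    by (simp add: eventually_at_split eventually_nhds_conv_at)
qed

text \<open>The utility may jump, so attainment rests on compactness and upper semicontinuity: first
  some maximiser exists, then the supremum of all maximisers is again one.\<close>

lemma
  assumes mono: "mono F" and rc: "\<And>x. continuous (at_right x) F"
    and F01: "\<And>b. F b \<in> {0..1}" and v: "v \<in> {0..1}" and pos: "util v F (bstar v F) > 0"
  shows bstar_in_01: "bstar v F \<in> {0..1}"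
    and util_le_bstar: "\<And>b. b \<in> {0..1} \<Longrightarrow> util v F b \<le> util v F (bstar v F)"
proof -
  let ?U = "util v F" and ?I = "{0..1::real}"
  let ?X = "{b \<in> ?I. \<forall>b'\<in>?I. ?U b' \<le> ?U b}"
  note usc = util_upper_semicontinuous[OF mono rc]
  have F0: "F b \<ge> 0" for b using F01[of b] by simp
  have U1: "?U b \<le> 1" if "b \<in> ?I" for b
  proof -
    have "(v - b) * F b \<le> 1 * F b" using that v F0[of b] by (intro mult_right_mono) auto
    then show ?thesis using F01[of b] by (simp add: util_def)
  qed
  have bdd: "bdd_above (?U ` ?I)" using U1 by (intro bdd_aboveI[of _ 1]) auto
  define S where "S = (SUP b\<in>?I. ?U b)"
  have US: "?U b \<le> S" if "b \<in> ?I" for b unfolding S_def by (rule cSUP_upper[OF that bdd])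
  have U00: "?U 0 \<ge> 0" using v F0[of 0] by (simp add: util_def)
  have "\<exists>x\<in>?I. ?U x \<ge> S"
  proof (cases "S > 0")
    \<comment> \<open>Semicontinuity is available only at positive levels. If the supremum is not
      positive, the bid 0 attains it, its utility being nonnegative.\<close>
    case False
    then show ?thesis using U00 by (intro bexI[of _ 0]) auto
  next
    case True
    have "\<exists>x\<in>?I. ?U x > S - inverse (real (Suc n))" for n
    proof -
      have "S - inverse (real (Suc n)) < (SUP b\<in>?I. ?U b)" unfolding S_def[symmetric] by simp
      then show ?thesis by (subst (asm) less_cSUP_iff[OF _ bdd]) auto
    qed
    then obtain x where x: "\<And>n. x n \<in> ?I" "\<And>n. ?U (x n) > S - inverse (real (Suc n))"
      by metis
    have "seq_compact ?I" by (intro compact_imp_seq_compact) simp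
    then obtain l r where l: "l \<in> ?I" "strict_mono r" "(x \<circ> r) \<longlonglongrightarrow> l"
      using x(1) by (metis seq_compactE)
    \<comment> \<open>Otherwise some level \<open>a < S\<close> would eventually bound the utility
      along the maximising subsequence, whose values come arbitrarily close to
      \<open>S\<close>.\<close>
    have "?U l \<ge> S"
    proof (rule ccontr)
      assume "\<not> ?U l \<ge> S"
      then have "max (?U l) 0 < S" using True by simp
      then obtain a where a: "max (?U l) 0 < a" "a < S" using dense by blast
      have "eventually (\<lambda>y. ?U y < a) (nhds l)" using a F0 by (intro usc) auto
      then have "eventually (\<lambda>n. ?U ((x \<circ> r) n) < a) sequentially"
        using l(3) by (rule eventually_compose_filterlim)
      moreover have "eventually (\<lambda>n. inverse (real (Suc n)) < S - a) sequentially"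
        using order_tendstoD(2)[OF LIMSEQ_inverse_real_of_nat, of "S - a"] a by simp
      ultimately have "eventually (\<lambda>n. False) sequentially"
      proof eventually_elim
        case (elim n)
        have "inverse (real (Suc (r n))) \<le> inverse (real (Suc n))"
          using seq_suble[OF l(2), of n] by simp
        with elim x(2)[of "r n"] show False by simp
      qed
      then show False by simp
    qed
    with l(1) show ?thesis by blast
  qed
  then obtain x where x: "x \<in> ?I" "?U x \<ge> S" by blast
  have xX: "x \<in> ?X" using x US by force
  have X: "?X = {b \<in> ?I. ?U b = S}" 
  proof safe
    fix b assume b: "b \<in> ?I" "\<forall>b'\<in>?I. ?U b' \<le> ?U b"
    then have "?U x \<le> ?U b" using x by blast
    then show "?U b = S" using x US[OF b(1)] by simp
  qed (use US in auto)
  have bX: "bdd_above ?X" by (intro bdd_aboveI[of _ 1]) auto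
  have bs: "bstar v F = Sup ?X" by (simp add: bstar_def)
  show in01: "bstar v F \<in> ?I" unfolding bs
    using cSup_upper[OF xX bX] xX cSup_least[of ?X 1] by fastforce
  have "S > 0" using US[OF in01] pos by simp
  \<comment> \<open>Otherwise all utilities near \<open>bstar v F\<close> would be below
    \<open>S\<close>, although maximisers lie arbitrarily close to their supremum.\<close>
  have "?U (bstar v F) \<ge> S"
  proof (rule ccontr)
    assume "\<not> ?U (bstar v F) \<ge> S"
    then have "eventually (\<lambda>y. ?U y < S) (nhds (bstar v F))" using \<open>S > 0\<close> F0 by (intro usc) auto
    then obtain d where d: "d > 0" "\<And>y. dist y (bstar v F) < d \<Longrightarrow> ?U y < S"
      unfolding eventually_nhds_metric by blast
    have "bstar v F - d < Sup ?X" using d bs by simp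
    then obtain y where y: "y \<in> ?X" "bstar v F - d < y" using xX by (elim less_cSupE) auto
    moreover have "y \<le> bstar v F" unfolding bs by (rule cSup_upper[OF y(1) bX])
    ultimately have "?U y < S" using d(1) by (intro d(2)) (auto simp: dist_real_def)
    then show False using y(1) unfolding X by simp
  qed
  then show "?U b \<le> ?U (bstar v F)" if "b \<in> ?I" for b using US[OF that] by simp
qed

text \<open>A variable inserted into its own distribution function is stochastically at least
  uniform. The set is closed downwards: if it contains its supremum, its measure is at most the
  value of the distribution function there; if not, at most a left limit; if it is unbounded,
  letting the argument tend to infinity gives \<open>1 \<le> u\<close>.\<close>

lemma (in real_distribution) measure_cdf_less_le:
  assumes "u \<ge> 0"
  shows "measure M {x. cdf M x < u} \<le> u"
proof -
  let ?S = "{x. cdf M x < u}"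
  have down: "x \<in> ?S" if "y \<in> ?S" "x \<le> y" for x y using cdf_nondecreasing[OF that(2)] that(1) by simp
  consider "?S = {}" | "?S \<noteq> {}" "bdd_above ?S" | "\<not> bdd_above ?S" by argo
  then show ?thesis
  proof cases
    case 1
    then show ?thesis using assms by simp
  next
    case 2
    define q where "q = Sup ?S"
    have le: "x \<le> q" if "x \<in> ?S" for x unfolding q_def by (rule cSup_upper[OF that 2(2)])
    show ?thesis
    proof (cases "q \<in> ?S")
      case True
      have "measure M ?S \<le> measure M {..q}" using le by (intro finite_measure_mono) auto
      with True show ?thesis by (simp add: cdf_def2)
    next
      case False
      have "measure M ?S \<le> measure M {..<q}" using le False by (intro finite_measure_mono) force+
      also have "\<dots> \<le> u"
      proof (rule tendsto_upperbound[OF cdf_at_left])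
        have "cdf M x \<le> u" if "x < q" for x
        proof -
          from that 2 obtain y where "y \<in> ?S" "x < y" unfolding q_def by (elim less_cSupE) auto
          with down[of y x] show ?thesis by simp
        qed
        then show "eventually (\<lambda>x. cdf M x \<le> u) (at_left q)"
          by (simp add: eventually_at_filter)
      qed simp
      finally show ?thesis .
    qed
  next
    case 3
    have "cdf M x \<le> u" for x
    proof -
      from 3 obtain y where "y \<in> ?S" "y > x" unfolding bdd_above_def by (meson not_less)
      with down[of y x] show ?thesis by simp
    qed
    then have "1 \<le> u" by (intro tendsto_upperbound[OF cdf_lim_at_top_prob]) auto
    then show ?thesis by (meson order_trans prob_le_1)
  qed
qed

subsection \<open>Exponential moments and independence of the past\<close>

text \<open>Hoeffding's lemma for either sign of \<open>l\<close>, so that both tails can be treated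
  alike. For negative \<open>l\<close> it is applied to \<open>- Y\<close>, which takes values in
  [-1, 0].\<close>

lemma (in prob_space) hoeffding_lemma_01:
  assumes Y[measurable]: "random_variable borel Y" and Y01: "\<And>\<omega>. \<omega> \<in> space M \<Longrightarrow> Y \<omega> \<in> {0..1}"
  shows "(\<integral>\<^sup>+\<omega>. ennreal (exp (l * (Y \<omega> - expectation Y))) \<partial>M) \<le> ennreal (exp (l\<^sup>2 / 8))"
proof -
  have *: "(\<integral>\<^sup>+\<omega>. ennreal (exp (k * (X \<omega> - expectation X))) \<partial>M) \<le> ennreal (exp (k\<^sup>2 / 8))"
    if "k > 0" "random_variable borel X" "AE \<omega> in M. X \<omega> \<in> {a..a+1}" for k a X
  proof -
    interpret interval_bounded_random_variable M X a "a + 1"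
      using that by unfold_locales auto
    show ?thesis using Hoeffdings_lemma_nn_integral[OF that(1)] by simp
  qed
  consider "l > 0" | "l = 0" | "l < 0" by linarith
  then show ?thesis
  proof cases
    case 1
    then show ?thesis using *[of l Y 0] Y01 by auto
  next
    case 2
    then show ?thesis by (simp add: emeasure_space_1)
  next
    case 3
    then show ?thesis using *[of "-l" "\<lambda>\<omega>. - Y \<omega>" "-1"] Y01 by (simp add: algebra_simps)
  qed
qed

text \<open>Markov's inequality for \<open>exp H\<close>, the Chernoff step for the supermartingales
  below.\<close>

lemma (in prob_space) prob_le_exp_of_nn_integral_exp_le_1:
  assumes [measurable]: "H \<in> borel_measurable M" and "(\<integral>\<^sup>+\<omega>. ennreal (exp (H \<omega>)) \<partial>M) \<le> 1"
    and A[measurable]: "A \<in> events" and "\<And>\<omega>. \<omega> \<in> A \<Longrightarrow> H \<omega> \<ge> x"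
  shows "prob A \<le> exp (- x)"
proof -
  have "emeasure M A = (\<integral>\<^sup>+\<omega>. indicator A \<omega> \<partial>M)" by simp
  also have "\<dots> \<le> (\<integral>\<^sup>+\<omega>. ennreal (exp (- x)) * ennreal (exp (H \<omega>)) \<partial>M)"
    using assms(4)
    by (intro nn_integral_mono)
       (auto simp: indicator_def simp flip: ennreal_mult exp_add ennreal_1 intro!: ennreal_leI)
  also have "\<dots> = ennreal (exp (- x)) * (\<integral>\<^sup>+\<omega>. ennreal (exp (H \<omega>)) \<partial>M)"
    by (intro nn_integral_cmult) auto
  also have "\<dots> \<le> ennreal (exp (- x)) * 1" by (intro mult_left_mono assms) auto
  finally show ?thesis by (simp add: emeasure_eq_measure)
qed

text \<open>Replaces conditional expectation given \<open>X\<close>: the joint law is a product, so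
  by Tonelli the integral over \<open>Y\<close> may be bounded with the value of \<open>X\<close>
  frozen.\<close>

lemma (in prob_space) nn_integral_indep_le:
  assumes ind: "indep_var N X L Y" and K[measurable]: "K \<in> borel_measurable (N \<Otimes>\<^sub>M L)"
    and h[measurable]: "h \<in> borel_measurable N"
    and le: "\<And>x. x \<in> space N \<Longrightarrow> (\<integral>\<^sup>+\<omega>. K (x, Y \<omega>) \<partial>M) \<le> h x"
  shows "(\<integral>\<^sup>+\<omega>. K (X \<omega>, Y \<omega>) \<partial>M) \<le> (\<integral>\<^sup>+\<omega>. h (X \<omega>) \<partial>M)"
proof -
  from ind have X[measurable]: "random_variable N X" and Y[measurable]: "random_variable L Y"
    and eq: "distr M N X \<Otimes>\<^sub>M distr M L Y = distr M (N \<Otimes>\<^sub>M L) (\<lambda>\<omega>. (X \<omega>, Y \<omega>))"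
    unfolding indep_var_distribution_eq by auto
  interpret Y: prob_space "distr M L Y" by (rule prob_space_distr) fact
  have "(\<integral>\<^sup>+\<omega>. K (X \<omega>, Y \<omega>) \<partial>M) = (\<integral>\<^sup>+z. K z \<partial>distr M (N \<Otimes>\<^sub>M L) (\<lambda>\<omega>. (X \<omega>, Y \<omega>)))"
    by (subst nn_integral_distr) auto
  also have "\<dots> = (\<integral>\<^sup>+x. \<integral>\<^sup>+y. K (x, y) \<partial>distr M L Y \<partial>distr M N X)"
    unfolding eq[symmetric] by (subst Y.nn_integral_fst[symmetric]) auto
  also have "\<dots> \<le> (\<integral>\<^sup>+x. h x \<partial>distr M N X)"
    using le by (intro nn_integral_mono) (auto simp: nn_integral_distr)
  also have "\<dots> = (\<integral>\<^sup>+\<omega>. h (X \<omega>) \<partial>M)" by (subst nn_integral_distr) auto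
  finally show ?thesis .
qed

text \<open>Values and competing bids form one family over a sum type, so that independence of any
  past from any single new coordinate follows from one assumption. Positive optimal utility makes
  \<open>v\<close> and \<open>U(b) / v\<close> positive.\<close>

locale ucbid_auction = prob_space P for P :: "'a measure" +
  fixes V M :: "nat \<Rightarrow> 'a \<Rightarrow> real" and \<gamma> v :: real and F :: "real \<Rightarrow> real"
  assumes V_measurable [measurable]: "\<And>t. t \<ge> 1 \<Longrightarrow> V t \<in> borel_measurable P"
    and M_measurable [measurable]: "\<And>t. t \<ge> 1 \<Longrightarrow> M t \<in> borel_measurable P"
    and V01: "\<And>t \<omega>. t \<ge> 1 \<Longrightarrow> \<omega> \<in> space P \<Longrightarrow> V t \<omega> \<in> {0..1}"
    and M01: "\<And>t \<omega>. t \<ge> 1 \<Longrightarrow> \<omega> \<in> space P \<Longrightarrow> M t \<omega> \<in> {0..1}"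
    and V_distr: "\<And>t. t \<ge> 1 \<Longrightarrow> distr P borel (V t) = distr P borel (V 1)"
    and M_distr: "\<And>t. t \<ge> 1 \<Longrightarrow> distr P borel (M t) = distr P borel (M 1)"
    and indep: "indep_vars (\<lambda>_. borel) (case_sum V M) ({1..} <+> {1..})"
    and gamma: "\<gamma> > 2"
    and F_eq: "F = (\<lambda>b. measure P {\<omega> \<in> space P. M 1 \<omega> \<le> b})"
    and v_eq: "v = expectation (V 1)"
    and opt_pos: "util v F (bstar v F) > 0"
begin

lemma F_eq_cdf: "F = cdf (distr P borel (M 1))"
  unfolding F_eq cdf_def2 by (auto simp: measure_distr vimage_def Int_def conj_commute)

sublocale MD: real_distribution "distr P borel (M 1)"
  by (rule real_distribution_distr) simp

lemma F_mono: "mono F"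
  unfolding F_eq_cdf by (intro monoI MD.cdf_nondecreasing)

lemma F_measurable [measurable]: "F \<in> borel_measurable borel"
  by (rule borel_measurable_mono[OF F_mono])

lemma F01: "F b \<in> {0..1}"
  unfolding F_eq_cdf using MD.cdf_nonneg MD.cdf_bounded_prob by auto

lemma integrable_bounded_rv: "X \<in> borel_measurable P \<Longrightarrow> (\<And>\<omega>. \<omega> \<in> space P \<Longrightarrow> \<bar>X \<omega>\<bar> \<le> k) \<Longrightarrow> integrable P (X :: 'a \<Rightarrow> real)"
  by (rule integrable_const_bound[where B = k]) auto

lemma v01: "v \<in> {0..1}"
proof -
  have "0 \<le> expectation (V 1)" using V01[of 1] by (intro integral_nonneg_AE) auto
  moreover have "expectation (V 1) \<le> expectation (\<lambda>_. 1)"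
    using V01[of 1] by (intro integral_mono integrable_bounded_rv[of _ 1]) auto
  ultimately show ?thesis by (simp add: v_eq prob_space)
qed

lemmas F_right_cont = MD.cdf_is_right_cont[folded F_eq_cdf]
lemmas bstar01 = bstar_in_01[OF F_mono F_right_cont F01 v01 opt_pos]
lemmas bstar_max = util_le_bstar[OF F_mono F_right_cont F01 v01 opt_pos]

lemma expectation_V:
  assumes "t \<ge> 1"
  shows "expectation (V t) = v"
proof -
  have "expectation (V t) = (\<integral>x. x \<partial>distr P borel (V t))"
    using assms by (subst integral_distr) auto
  also have "\<dots> = (\<integral>x. x \<partial>distr P borel (V 1))" by (simp only: V_distr[OF assms])
  also have "\<dots> = v" unfolding v_eq by (subst integral_distr) auto
  finally show ?thesis .
qed

lemma expectation_M:
  assumes "t \<ge> 1" "\<phi> \<in> borel_measurable borel"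
  shows "expectation (\<lambda>\<omega>. \<phi> (M t \<omega>) :: real) = expectation (\<lambda>\<omega>. \<phi> (M 1 \<omega>))"
proof -
  have "expectation (\<lambda>\<omega>. \<phi> (M t \<omega>)) = (\<integral>x. \<phi> x \<partial>distr P borel (M t))"
    using assms by (subst integral_distr) auto
  also have "\<dots> = (\<integral>x. \<phi> x \<partial>distr P borel (M 1))" by (simp only: M_distr[OF assms(1)])
  also have "\<dots> = expectation (\<lambda>\<omega>. \<phi> (M 1 \<omega>))" using assms by (subst integral_distr) auto
  finally show ?thesis .
qed

lemma expectation_M_le: "t \<ge> 1 \<Longrightarrow> expectation (\<lambda>\<omega>. if M t \<omega> \<le> b then 1 else 0 :: real) = F b"
proof -
  assume t: "t \<ge> 1"
  have "expectation (\<lambda>\<omega>. if M t \<omega> \<le> b then 1 else 0 :: real) = expectation (\<lambda>\<omega>. if M 1 \<omega> \<le> b then 1 else 0)"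
    using expectation_M[OF t, of "\<lambda>x. if x \<le> b then 1 else 0"] by simp
  also have "\<dots> = expectation (indicator {\<omega> \<in> space P. M 1 \<omega> \<le> b})"
    by (intro Bochner_Integration.integral_cong) (auto simp: indicator_def)
  also have "\<dots> = F b" by (simp add: F_eq)
  finally show ?thesis .
qed

text \<open>The conditioning step of the supermartingale arguments: \<open>\<Phi>\<close> summarises
  the past and coordinate \<open>k\<close> is fresh. Values and competing bids have separate
  horizons, since the value of a round is integrated after its competing bid is known. Measurability
  is required over general spaces because \<open>\<Phi>\<close> is evaluated on the product of the
  past coordinates.\<close>

lemma nn_integral_past_le:
  fixes \<Phi> :: "(nat \<Rightarrow> real) \<Rightarrow> (nat \<Rightarrow> real) \<Rightarrow> real \<times> real" and K h i j k
  defines "A \<equiv> Inl ` {1..<i} \<union> Inr ` {1..<j :: nat}"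
  assumes k: "k \<in> {1..} <+> {1..}" "k \<notin> A"
    and meas: "\<And>(N :: (nat + nat \<Rightarrow> real) measure) vs m.
      (\<And>s. s \<in> {1..<i} \<Longrightarrow> vs s \<in> borel_measurable N) \<Longrightarrow> (\<And>s. s \<in> {1..<j} \<Longrightarrow> m s \<in> borel_measurable N) \<Longrightarrow>
      (\<And>s x. vs s x \<in> {0..1}) \<Longrightarrow> (\<And>s x. m s x \<in> {0..1}) \<Longrightarrow>
      (\<lambda>x. \<Phi> (\<lambda>s. vs s x) (\<lambda>s. m s x)) \<in> borel_measurable N"
    and local: "\<And>vs vs' m m'. (\<And>s. s \<in> {1..<i} \<Longrightarrow> vs s = vs' s) \<Longrightarrow> (\<And>s. s \<in> {1..<j} \<Longrightarrow> m s = m' s) \<Longrightarrow>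
      \<Phi> vs m = \<Phi> vs' m'"
    and K[measurable]: "K \<in> borel_measurable (borel \<Otimes>\<^sub>M borel)" and h[measurable]: "h \<in> borel_measurable borel"
    and le: "\<And>x. (\<integral>\<^sup>+\<omega>. K (x, case_sum V M k \<omega>) \<partial>P) \<le> h x"
  shows "(\<integral>\<^sup>+\<omega>. K (\<Phi> (\<lambda>s. V s \<omega>) (\<lambda>s. M s \<omega>), case_sum V M k \<omega>) \<partial>P)
    \<le> (\<integral>\<^sup>+\<omega>. h (\<Phi> (\<lambda>s. V s \<omega>) (\<lambda>s. M s \<omega>)) \<partial>P)"
proof -
  \<comment> \<open>Coordinates of the product space are not confined to the unit interval, which measurability
    of the bids needs, hence the clamping.\<close>
  define cl where "cl x = max 0 (min 1 x)" for x :: real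
  have [measurable]: "cl \<in> borel_measurable borel" unfolding cl_def by measurable
  define f where "f x = \<Phi> (\<lambda>s. cl (x (Inl s))) (\<lambda>s. cl (x (Inr s)))" for x :: "nat + nat \<Rightarrow> real"
  let ?X = "\<lambda>\<omega>. restrict (\<lambda>i. case_sum V M i \<omega>) A"
  have f[measurable]: "f \<in> borel_measurable (Pi\<^sub>M A (\<lambda>_. borel))"
    unfolding f_def
  proof (rule meas)
    fix s assume "s \<in> {1..<i}"
    then have [measurable]: "Inl s \<in> A" by (simp add: A_def)
    show "(\<lambda>x. cl (x (Inl s))) \<in> borel_measurable (Pi\<^sub>M A (\<lambda>_. borel))" by measurable
  next
    fix s assume "s \<in> {1..<j}"
    then have [measurable]: "Inr s \<in> A" by (simp add: A_def)
    show "(\<lambda>x. cl (x (Inr s))) \<in> borel_measurable (Pi\<^sub>M A (\<lambda>_. borel))" by measurable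
  qed (auto simp: cl_def)
  have ind: "indep_var (Pi\<^sub>M A (\<lambda>_. borel)) ?X (Pi\<^sub>M {k} (\<lambda>_. borel)) (\<lambda>\<omega>. restrict (\<lambda>i. case_sum V M i \<omega>) {k})"
    by (rule indep_var_restrict[OF indep]) (use k in \<open>auto simp: A_def\<close>)
  have eq: "f (?X \<omega>) = \<Phi> (\<lambda>s. V s \<omega>) (\<lambda>s. M s \<omega>)" if "\<omega> \<in> space P" for \<omega>
    unfolding f_def
  proof (rule local)
    fix s assume "s \<in> {1..<i}"
    then show "cl (?X \<omega> (Inl s)) = V s \<omega>" using V01[of s \<omega>] that by (auto simp: A_def cl_def)
  next
    fix s assume "s \<in> {1..<j}"
    then show "cl (?X \<omega> (Inr s)) = M s \<omega>" using M01[of s \<omega>] that by (auto simp: A_def cl_def)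
  qed
  let ?Y = "\<lambda>\<omega>. restrict (\<lambda>i. case_sum V M i \<omega>) {k}"
  have "(\<integral>\<^sup>+\<omega>. K (\<Phi> (\<lambda>s. V s \<omega>) (\<lambda>s. M s \<omega>), case_sum V M k \<omega>) \<partial>P) =
      (\<integral>\<^sup>+\<omega>. (\<lambda>z. K (f (fst z), snd z k)) (?X \<omega>, ?Y \<omega>) \<partial>P)"
    by (intro nn_integral_cong) (simp only: eq fst_conv snd_conv restrict_apply singletonI if_True)
  also have "\<dots> \<le> (\<integral>\<^sup>+\<omega>. h (f (?X \<omega>)) \<partial>P)"
  proof (rule nn_integral_indep_le[OF ind])
    show "(\<lambda>z. K (f (fst z), snd z k)) \<in> borel_measurable (Pi\<^sub>M A (\<lambda>_. borel) \<Otimes>\<^sub>M Pi\<^sub>M {k} (\<lambda>_. borel))"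
      by measurable
    show "(\<integral>\<^sup>+\<omega>. K (f (fst (x, ?Y \<omega>)), snd (x, ?Y \<omega>) k) \<partial>P) \<le> h (f x)" for x
      using le[of "f x"] by (simp only: fst_conv snd_conv restrict_apply singletonI if_True)
  qed measurable
  also have "\<dots> = (\<integral>\<^sup>+\<omega>. h (\<Phi> (\<lambda>s. V s \<omega>) (\<lambda>s. M s \<omega>)) \<partial>P)"
    by (intro nn_integral_cong) (simp only: eq)
  finally show ?thesis .
qed

end

text \<open>One supermartingale step: \<open>a\<close> is the exponent accumulated so far, and
  subtracting \<open>l\<^sup>2 / 8\<close> cancels the bound of Hoeffding's lemma.\<close>

lemma (in prob_space) nn_integral_exp_centred_le:
  assumes "random_variable borel Y" "\<And>\<omega>. \<omega> \<in> space M \<Longrightarrow> Y \<omega> \<in> {0..1}"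
  shows "(\<integral>\<^sup>+\<omega>. ennreal (exp (a + (l * (expectation Y - Y \<omega>) - l\<^sup>2 / 8))) \<partial>M) \<le> ennreal (exp a)"
proof -
  have [measurable]: "random_variable borel Y" by fact
  have "(\<integral>\<^sup>+\<omega>. ennreal (exp (a + (l * (expectation Y - Y \<omega>) - l\<^sup>2 / 8))) \<partial>M) =
      (\<integral>\<^sup>+\<omega>. ennreal (exp (a - l\<^sup>2 / 8)) * ennreal (exp (- l * (Y \<omega> - expectation Y))) \<partial>M)"
    by (intro nn_integral_cong) (simp add: algebra_simps flip: ennreal_mult exp_add)
  also have "\<dots> = ennreal (exp (a - l\<^sup>2 / 8)) * (\<integral>\<^sup>+\<omega>. ennreal (exp (- l * (Y \<omega> - expectation Y))) \<partial>M)"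
    by (intro nn_integral_cmult) auto
  also have "\<dots> \<le> ennreal (exp (a - l\<^sup>2 / 8)) * ennreal (exp ((- l)\<^sup>2 / 8))"
    by (intro mult_left_mono hoeffding_lemma_01 assms) auto
  also have "\<dots> = ennreal (exp a)" by (simp flip: ennreal_mult exp_add)
  finally show ?thesis .
qed

section \<open>Exponential supermartingales for observed values and for wins\<close>

context ucbid_auction
begin

lemma gamma_nonneg: "\<gamma> \<ge> 0" using gamma by simp

definition bid :: "nat \<Rightarrow> 'a \<Rightarrow> real" where
  "bid t \<omega> = ucbid \<gamma> (\<lambda>s. V s \<omega>) (\<lambda>s. M s \<omega>) t"

lemma bid_measurable [measurable]: "t \<ge> 1 \<Longrightarrow> bid t \<in> borel_measurable P"
  unfolding bid_def using gamma V01 M01 by (intro ucbid_measurable) auto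

lemma bid01: "t \<ge> 1 \<Longrightarrow> \<omega> \<in> space P \<Longrightarrow> bid t \<omega> \<in> {0..1}"
  unfolding bid_def using gamma V01 M01 by (intro ucbid_in_01) auto

text \<open>The compensator \<open>l\<^sup>2 / 8\<close> is the bound of Hoeffding's lemma, so that the exponentials of both
  sums are supermartingales.\<close>

definition value_exponent :: "real \<Rightarrow> nat \<Rightarrow> (nat \<Rightarrow> real) \<Rightarrow> (nat \<Rightarrow> real) \<Rightarrow> real" where
  "value_exponent l t vs m =
     (\<Sum>s\<in>{1..<t}. if m s \<le> ucbid \<gamma> vs m s then l * (v - vs s) - l\<^sup>2 / 8 else 0)"

definition win_exponent :: "real \<Rightarrow> nat \<Rightarrow> (nat \<Rightarrow> real) \<Rightarrow> (nat \<Rightarrow> real) \<Rightarrow> real" where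
  "win_exponent l t vs m =
     (\<Sum>s\<in>{1..<t}. l * (F (ucbid \<gamma> vs m s) - (if m s \<le> ucbid \<gamma> vs m s then 1 else 0)) - l\<^sup>2 / 8)"

text \<open>Whether round \<open>t\<close> is won depends on the past and on \<open>M t\<close>,
  hence not on \<open>V t\<close>. Given these, the new factor is 1 after a loss and has mean at
  most 1 after a win, although the number of observed values is random.\<close>

lemma nn_integral_exp_value_exponent:
  "t \<ge> 1 \<Longrightarrow> (\<integral>\<^sup>+\<omega>. ennreal (exp (value_exponent l t (\<lambda>s. V s \<omega>) (\<lambda>s. M s \<omega>))) \<partial>P) \<le> 1"
proof (induction t rule: nat_induct_at_least)
  case base
  then show ?case by (simp add: value_exponent_def emeasure_space_1)
next
  case (Suc t)
  \<comment> \<open>The sign of the second component tells whether the round is won. It involves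
    \<open>m t\<close>, which is why the horizon for the competing bids is \<open>Suc t\<close>
    below.\<close>
  define \<Phi> where "\<Phi> vs m = (value_exponent l t vs m, m t - ucbid \<gamma> vs m t)" for vs m
  define K :: "(real \<times> real) \<times> real \<Rightarrow> ennreal"
    where "K z = ennreal (exp (fst (fst z) + (if snd (fst z) \<le> 0 then l * (v - snd z) - l\<^sup>2 / 8 else 0)))" for z
  have "K \<in> borel_measurable ((borel \<Otimes>\<^sub>M borel) \<Otimes>\<^sub>M borel)" unfolding K_def by measurable
  then have K: "K \<in> borel_measurable (borel \<Otimes>\<^sub>M borel)" by (simp only: borel_prod)
  have "(\<integral>\<^sup>+\<omega>. ennreal (exp (value_exponent l (Suc t) (\<lambda>s. V s \<omega>) (\<lambda>s. M s \<omega>))) \<partial>P) =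
      (\<integral>\<^sup>+\<omega>. K (\<Phi> (\<lambda>s. V s \<omega>) (\<lambda>s. M s \<omega>), case_sum V M (Inl t) \<omega>) \<partial>P)"
    using Suc.hyps by (intro nn_integral_cong) (simp add: K_def \<Phi>_def value_exponent_def)
  also have "\<dots> \<le> (\<integral>\<^sup>+\<omega>. ennreal (exp (fst (\<Phi> (\<lambda>s. V s \<omega>) (\<lambda>s. M s \<omega>)))) \<partial>P)"
  proof (rule nn_integral_past_le[where i = t and j = "Suc t" and h = "\<lambda>x. ennreal (exp (fst x))"])
    show "Inl t \<in> {1..} <+> {1..}" using Suc.hyps by auto
    show "Inl t \<notin> Inl ` {1..<t} \<union> Inr ` {1..<Suc t}" by auto
  next
    fix N :: "(nat + nat \<Rightarrow> real) measure" and vs m :: "nat \<Rightarrow> _ \<Rightarrow> real"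
    assume vs[measurable]: "\<And>s. s \<in> {1..<t} \<Longrightarrow> vs s \<in> borel_measurable N"
      and m[measurable]: "\<And>s. s \<in> {1..<Suc t} \<Longrightarrow> m s \<in> borel_measurable N"
      and b: "\<And>s x. vs s x \<in> {0..1}" "\<And>s x. m s x \<in> {0..1}"
    have [measurable]: "(\<lambda>x. ucbid \<gamma> (\<lambda>s. vs s x) (\<lambda>s. m s x) s) \<in> borel_measurable N" if "s \<in> {1..<Suc t}" for s
      using that b gamma_nonneg by (intro ucbid_measurable vs m) auto
    have [measurable]: "t \<in> {1..<Suc t}" "\<And>s. s \<in> {1..<t} \<Longrightarrow> s \<in> {1..<Suc t}" using Suc.hyps by auto
    show "(\<lambda>x. \<Phi> (\<lambda>s. vs s x) (\<lambda>s. m s x)) \<in> borel_measurable N"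
      unfolding \<Phi>_def value_exponent_def borel_prod[symmetric] by measurable
  next
    fix vs vs' m m' :: "nat \<Rightarrow> real"
    assume eq: "\<And>s. s \<in> {1..<t} \<Longrightarrow> vs s = vs' s" "\<And>s. s \<in> {1..<Suc t} \<Longrightarrow> m s = m' s"
    have "ucbid \<gamma> vs m s = ucbid \<gamma> vs' m' s" if "s \<in> {1..<Suc t}" for s
      using that by (intro ucbid_cong eq) auto
    then show "\<Phi> vs m = \<Phi> vs' m'" unfolding \<Phi>_def value_exponent_def using eq Suc.hyps
      by (auto intro!: sum.cong)
  next
    fix x :: "real \<times> real"
    show "(\<integral>\<^sup>+\<omega>. K (x, case_sum V M (Inl t) \<omega>) \<partial>P) \<le> ennreal (exp (fst x))"
    proof (cases "snd x \<le> 0")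
      case True
      then show ?thesis using Suc.hyps nn_integral_exp_centred_le[of "V t" "fst x" l] V01
        by (simp add: K_def expectation_V)
    next
      case False
      then show ?thesis by (simp add: K_def emeasure_space_1)
    qed
  qed (use K in \<open>auto simp: borel_prod[symmetric]\<close>)
  also have "\<dots> \<le> 1" using Suc.IH by (simp add: \<Phi>_def)
  finally show ?case .
qed

text \<open>The bid is determined by the past and \<open>M t\<close> is fresh, so conditionally a
  win is a Bernoulli variable with mean \<open>F\<close> of the bid.\<close>

lemma nn_integral_exp_win_exponent:
  "t \<ge> 1 \<Longrightarrow> (\<integral>\<^sup>+\<omega>. ennreal (exp (win_exponent l t (\<lambda>s. V s \<omega>) (\<lambda>s. M s \<omega>))) \<partial>P) \<le> 1"
proof (induction t rule: nat_induct_at_least)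
  case base
  then show ?case by (simp add: win_exponent_def emeasure_space_1)
next
  case (Suc t)
  define \<Phi> where "\<Phi> vs m = (win_exponent l t vs m, ucbid \<gamma> vs m t)" for vs m
  define K :: "(real \<times> real) \<times> real \<Rightarrow> ennreal"
    where "K z = ennreal (exp (fst (fst z) +
      (l * (F (snd (fst z)) - (if snd z \<le> snd (fst z) then 1 else 0)) - l\<^sup>2 / 8)))" for z
  have "K \<in> borel_measurable ((borel \<Otimes>\<^sub>M borel) \<Otimes>\<^sub>M borel)" unfolding K_def by measurable
  then have K: "K \<in> borel_measurable (borel \<Otimes>\<^sub>M borel)" by (simp only: borel_prod)
  have "(\<integral>\<^sup>+\<omega>. ennreal (exp (win_exponent l (Suc t) (\<lambda>s. V s \<omega>) (\<lambda>s. M s \<omega>))) \<partial>P) =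
      (\<integral>\<^sup>+\<omega>. K (\<Phi> (\<lambda>s. V s \<omega>) (\<lambda>s. M s \<omega>), case_sum V M (Inr t) \<omega>) \<partial>P)"
    using Suc.hyps by (intro nn_integral_cong) (simp add: K_def \<Phi>_def win_exponent_def)
  also have "\<dots> \<le> (\<integral>\<^sup>+\<omega>. ennreal (exp (fst (\<Phi> (\<lambda>s. V s \<omega>) (\<lambda>s. M s \<omega>)))) \<partial>P)"
  proof (rule nn_integral_past_le[where i = t and j = t and h = "\<lambda>x. ennreal (exp (fst x))"])
    show "Inr t \<in> {1..} <+> {1..}" using Suc.hyps by auto
    show "Inr t \<notin> Inl ` {1..<t} \<union> Inr ` {1..<t}" by auto
  next
    fix N :: "(nat + nat \<Rightarrow> real) measure" and vs m :: "nat \<Rightarrow> _ \<Rightarrow> real"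
    assume vs[measurable]: "\<And>s. s \<in> {1..<t} \<Longrightarrow> vs s \<in> borel_measurable N"
      and m[measurable]: "\<And>s. s \<in> {1..<t} \<Longrightarrow> m s \<in> borel_measurable N"
      and b: "\<And>s x. vs s x \<in> {0..1}" "\<And>s x. m s x \<in> {0..1}"
    have [measurable]: "(\<lambda>x. ucbid \<gamma> (\<lambda>s. vs s x) (\<lambda>s. m s x) s) \<in> borel_measurable N" if "s \<in> {1..<Suc t}" for s
      using that b gamma_nonneg by (intro ucbid_measurable vs m) auto
    have [measurable]: "t \<in> {1..<Suc t}" "\<And>s. s \<in> {1..<t} \<Longrightarrow> s \<in> {1..<Suc t}" using Suc.hyps by auto
    show "(\<lambda>x. \<Phi> (\<lambda>s. vs s x) (\<lambda>s. m s x)) \<in> borel_measurable N"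
      unfolding \<Phi>_def win_exponent_def borel_prod[symmetric] by measurable
  next
    fix vs vs' m m' :: "nat \<Rightarrow> real"
    assume eq: "\<And>s. s \<in> {1..<t} \<Longrightarrow> vs s = vs' s" "\<And>s. s \<in> {1..<t} \<Longrightarrow> m s = m' s"
    have "ucbid \<gamma> vs m s = ucbid \<gamma> vs' m' s" if "s \<in> {1..<Suc t}" for s
      using that by (intro ucbid_cong eq) auto
    then show "\<Phi> vs m = \<Phi> vs' m'" unfolding \<Phi>_def win_exponent_def using eq Suc.hyps
      by (auto intro!: sum.cong)
  next
    fix x :: "real \<times> real"
    show "(\<integral>\<^sup>+\<omega>. K (x, case_sum V M (Inr t) \<omega>) \<partial>P) \<le> ennreal (exp (fst x))"
      using Suc.hyps nn_integral_exp_centred_le[of "\<lambda>\<omega>. if M t \<omega> \<le> snd x then 1 else 0" "fst x" l]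
      by (simp add: K_def expectation_M_le)
  qed (use K in \<open>auto simp: borel_prod[symmetric]\<close>)
  also have "\<dots> \<le> 1" using Suc.IH by (simp add: \<Phi>_def)
  finally show ?case .
qed

end

subsection \<open>Concentration\<close>

context ucbid_auction
begin

definition nwins :: "nat \<Rightarrow> 'a \<Rightarrow> nat" where
  "nwins t \<omega> = Nwins (\<lambda>s. bid s \<omega>) (\<lambda>s. M s \<omega>) t"

definition vhat :: "nat \<Rightarrow> 'a \<Rightarrow> real" where
  "vhat t \<omega> = Vhat (\<lambda>s. bid s \<omega>) (\<lambda>s. V s \<omega>) (\<lambda>s. M s \<omega>) t"

definition radius :: "nat \<Rightarrow> 'a \<Rightarrow> real" where
  "radius t \<omega> = epsb \<gamma> (\<lambda>s. bid s \<omega>) (\<lambda>s. M s \<omega>) t"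

definition fhat :: "nat \<Rightarrow> 'a \<Rightarrow> real \<Rightarrow> real" where
  "fhat t \<omega> b = Fhat (\<lambda>s. M s \<omega>) t b"

lemma measurable_past [measurable]:
  "s \<in> {1..<t} \<Longrightarrow> V s \<in> borel_measurable P"
  "s \<in> {1..<t} \<Longrightarrow> M s \<in> borel_measurable P"
  "s \<in> {1..<t} \<Longrightarrow> bid s \<in> borel_measurable P"
  by auto

lemma nwins_eq_sum: "real (nwins t \<omega>) = (\<Sum>s\<in>{1..<t}. if M s \<omega> \<le> bid s \<omega> then 1 else 0)"
  unfolding nwins_def by (rule Nwins_eq_sum)

lemma nwins_measurable [measurable]: "(\<lambda>\<omega>. real (nwins t \<omega>)) \<in> borel_measurable P"
  unfolding nwins_eq_sum by measurable

lemma nwins_eq_measurable [measurable]: "{\<omega> \<in> space P. nwins t \<omega> = k} \<in> events"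
proof -
  have "{\<omega> \<in> space P. nwins t \<omega> = k} = {\<omega> \<in> space P. real (nwins t \<omega>) = real k}" by simp
  also have "\<dots> \<in> events" by measurable
  finally show ?thesis .
qed

lemma vhat_measurable [measurable]: "vhat t \<in> borel_measurable P"
  unfolding vhat_def Vhat_def nwins_def[symmetric] by measurable

lemma radius_measurable [measurable]: "radius t \<in> borel_measurable P"
  unfolding radius_def epsb_def nwins_def[symmetric] by measurable

lemma fhat_measurable [measurable]: "(\<lambda>\<omega>. fhat t \<omega> b) \<in> borel_measurable P"
  unfolding fhat_def Fhat_eq_sum by measurable

text \<open>The first bid is 1 and always wins, so from the second round on the mean and the radius
  never divide by zero.\<close>

lemma nwins_bounds:
  assumes "n \<ge> 1" "\<omega> \<in> space P"
  shows "nwins (Suc n) \<omega> \<in> {1..n}"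
proof -
  have "1 \<in> {s \<in> {1..<Suc n}. M s \<omega> \<le> bid s \<omega>}"
    using assms M01[of 1 \<omega>] by (simp add: bid_def ucbid_1)
  then have "card {1 :: nat} \<le> card {s \<in> {1..<Suc n}. M s \<omega> \<le> bid s \<omega>}"
    by (intro card_mono) auto
  moreover have "card {s \<in> {1..<Suc n}. M s \<omega> \<le> bid s \<omega>} \<le> card {1..<Suc n}"
    by (intro card_mono) auto
  ultimately show ?thesis by (simp add: nwins_def Nwins_def)
qed

text \<open>The confidence radius for \<open>n\<close> observations; the width is chosen so that the
  Hoeffding bound \<open>exp (- 2 * n * (\<delta> n)\<^sup>2)\<close> equals
  \<open>n powr - \<gamma>\<close>.\<close>

definition \<delta> :: "nat \<Rightarrow> real" where
  "\<delta> n = sqrt (\<gamma> * ln (real n) / (2 * real n))"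

lemma \<delta>_nonneg: "\<delta> n \<ge> 0"
proof (cases "n = 0")
  case True
  then show ?thesis by (simp add: \<delta>_def)
next
  case False
  then show ?thesis using gamma by (auto simp: \<delta>_def)
qed

lemma \<delta>_sq: "n \<ge> 1 \<Longrightarrow> (\<delta> n)\<^sup>2 = \<gamma> * ln (real n) / (2 * real n)"
  unfolding \<delta>_def using gamma by (intro real_sqrt_pow2) auto

lemma exp_gamma_ln: "n \<ge> 1 \<Longrightarrow> exp (- (\<gamma> * ln (real n))) = real n powr - \<gamma>"
  by (simp add: powr_def)

text \<open>The number of wins is random, so the event is split according to its value
  \<open>k\<close> and the sign of the deviation. Each piece costs \<open>n powr - \<gamma>\<close>,
  and there are \<open>2 * n\<close> of them.\<close>

lemma prob_value_deviation:
  assumes n: "n \<ge> 1"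
  shows "prob {\<omega> \<in> space P. radius (Suc n) \<omega> < \<bar>vhat (Suc n) \<omega> - v\<bar>} \<le> 2 * real n powr (1 - \<gamma>)"
proof -
  let ?t = "Suc n"
  define W where "W \<omega> = (\<Sum>s\<in>{1..<?t}. if M s \<omega> \<le> bid s \<omega> then v - V s \<omega> else 0)" for \<omega>
  have [measurable]: "W \<in> borel_measurable P" unfolding W_def by measurable
  define e where "e k = sqrt (\<gamma> * ln (real n) / (2 * real k))" for k
  define A where "A k \<sigma> = {\<omega> \<in> space P. nwins ?t \<omega> = k \<and> real k * e k \<le> \<sigma> * W \<omega>}" for k \<sigma>
  have A_ev[measurable]: "A k \<sigma> \<in> events" for k \<sigma> unfolding A_def by measurable
  have expo: "value_exponent l ?t (\<lambda>s. V s \<omega>) (\<lambda>s. M s \<omega>) = l * W \<omega> - l\<^sup>2 / 8 * real (nwins ?t \<omega>)" for l \<omega>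
  proof -
    have "l * W \<omega> - l\<^sup>2 / 8 * real (nwins ?t \<omega>) =
        (\<Sum>s\<in>{1..<?t}. l * (if M s \<omega> \<le> bid s \<omega> then v - V s \<omega> else 0) - l\<^sup>2 / 8 * (if M s \<omega> \<le> bid s \<omega> then 1 else 0))"
      unfolding W_def nwins_eq_sum sum_subtractf sum_distrib_left ..
    also have "\<dots> = value_exponent l ?t (\<lambda>s. V s \<omega>) (\<lambda>s. M s \<omega>)"
      unfolding value_exponent_def bid_def by (intro sum.cong) auto
    finally show ?thesis ..
  qed
  have PA: "prob (A k \<sigma>) \<le> real n powr - \<gamma>" if k: "k \<ge> 1" and \<sigma>: "\<sigma>\<^sup>2 = 1" for k \<sigma>
  proof -
    have e2: "(e k)\<^sup>2 = \<gamma> * ln (real n) / (2 * real k)"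
      unfolding e_def using gamma n by (intro real_sqrt_pow2) auto
    have e0: "e k \<ge> 0" unfolding e_def using gamma n by auto
    have "prob (A k \<sigma>) \<le> exp (- (\<gamma> * ln (real n)))"
    proof (rule prob_le_exp_of_nn_integral_exp_le_1)
      \<comment> \<open>For \<open>k\<close> wins, \<open>l * k * e - l\<^sup>2 * k / 8\<close> is
        largest at \<open>l = 4 * e\<close>, with value
        \<open>2 * k * e\<^sup>2 = \<gamma> * ln n\<close>. The sign \<open>\<sigma>\<close> selects
        the tail.\<close>
      let ?l = "4 * e k * \<sigma>"
      show "(\<integral>\<^sup>+\<omega>. ennreal (exp (?l * W \<omega> - ?l\<^sup>2 / 8 * real (nwins ?t \<omega>))) \<partial>P) \<le> 1"
        using nn_integral_exp_value_exponent[of ?t ?l] by (simp add: expo)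
      show "(\<lambda>\<omega>. ?l * W \<omega> - ?l\<^sup>2 / 8 * real (nwins ?t \<omega>)) \<in> borel_measurable P" by measurable
      fix \<omega> assume "\<omega> \<in> A k \<sigma>"
      then have N: "nwins ?t \<omega> = k" and W: "real k * e k \<le> \<sigma> * W \<omega>" by (auto simp: A_def)
      have "\<gamma> * ln (real n) = 2 * real k * (e k)\<^sup>2" using e2 k by simp
      also have "\<dots> = 4 * e k * (real k * e k) - 2 * real k * (e k)\<^sup>2" by (simp add: power2_eq_square)
      also have "\<dots> \<le> 4 * e k * (\<sigma> * W \<omega>) - 2 * real k * (e k)\<^sup>2"
        using W e0 by (intro diff_right_mono mult_left_mono) auto
      also have "\<dots> = ?l * W \<omega> - ?l\<^sup>2 / 8 * real (nwins ?t \<omega>)"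
        by (simp add: N power_mult_distrib \<sigma>)
      finally show "\<gamma> * ln (real n) \<le> ?l * W \<omega> - ?l\<^sup>2 / 8 * real (nwins ?t \<omega>)" .
    qed auto
    then show ?thesis using n by (simp add: exp_gamma_ln)
  qed
  have "{\<omega> \<in> space P. radius ?t \<omega> < \<bar>vhat ?t \<omega> - v\<bar>} \<subseteq> (\<Union>k\<in>{1..n}. A k 1 \<union> A k (-1))"
  proof safe
    fix \<omega> assume w: "\<omega> \<in> space P" and dev: "radius ?t \<omega> < \<bar>vhat ?t \<omega> - v\<bar>"
    let ?k = "nwins ?t \<omega>"
    have k: "?k \<in> {1..n}" by (rule nwins_bounds[OF n w])
    have rad: "radius ?t \<omega> = e ?k" by (simp add: radius_def epsb_def e_def nwins_def)
    have "W \<omega> + (\<Sum>s\<in>{1..<?t}. if M s \<omega> \<le> bid s \<omega> then V s \<omega> else 0) = v * real ?k"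
      unfolding W_def nwins_eq_sum sum_distrib_left sum.distrib[symmetric] by (intro sum.cong) auto
    moreover have "(\<Sum>s\<in>{1..<?t}. if M s \<omega> \<le> bid s \<omega> then V s \<omega> else 0) = real ?k * vhat ?t \<omega>"
      using k by (simp add: vhat_def Vhat_def nwins_def)
    ultimately have W: "W \<omega> = real ?k * (v - vhat ?t \<omega>)" by (simp add: algebra_simps)
    have "real ?k * e ?k \<le> real ?k * \<bar>vhat ?t \<omega> - v\<bar>"
      using dev rad by (intro mult_left_mono) auto
    also have "\<dots> = \<bar>W \<omega>\<bar>" unfolding W by (simp add: abs_mult abs_minus_commute)
    finally have "\<omega> \<in> A ?k 1 \<union> A ?k (-1)" using w by (auto simp: A_def abs_if split: if_splits)
    with k show "\<omega> \<in> (\<Union>k\<in>{1..n}. A k 1 \<union> A k (-1))" by blast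
  qed
  then have "prob {\<omega> \<in> space P. radius ?t \<omega> < \<bar>vhat ?t \<omega> - v\<bar>} \<le> prob (\<Union>k\<in>{1..n}. A k 1 \<union> A k (-1))"
    by (intro finite_measure_mono) auto
  also have "\<dots> \<le> (\<Sum>k\<in>{1..n}. prob (A k 1 \<union> A k (-1)))" by (intro measure_UNION_le) auto
  also have "\<dots> \<le> (\<Sum>k\<in>{1..n}. 2 * real n powr - \<gamma>)"
  proof (intro sum_mono)
    fix k assume "k \<in> {1..n}"
    then have "prob (A k 1) \<le> real n powr - \<gamma>" "prob (A k (-1)) \<le> real n powr - \<gamma>"
      by (auto intro!: PA)
    moreover have "prob (A k 1 \<union> A k (-1)) \<le> prob (A k 1) + prob (A k (-1))"
      by (intro measure_Un_le) auto
    ultimately show "prob (A k 1 \<union> A k (-1)) \<le> 2 * real n powr - \<gamma>" by simp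
  qed
  also have "\<dots> = 2 * real n powr (1 - \<gamma>)" using n by (simp add: powr_diff powr_minus divide_simps)
  finally show ?thesis .
qed

text \<open>Competing bids are observed in every round whatever the bidder does, so Hoeffding's
  inequality for \<open>n\<close> i.i.d. terms applies directly.\<close>

lemma prob_M_deviation:
  assumes n: "n \<ge> 1" and [measurable]: "\<phi> \<in> borel_measurable borel" and \<phi>01: "\<And>x. \<phi> x \<in> {0..1}"
  defines "\<mu> \<equiv> expectation (\<lambda>\<omega>. \<phi> (M 1 \<omega>))"
  shows "prob {\<omega> \<in> space P. (\<Sum>s\<in>{1..<Suc n}. \<phi> (M s \<omega>)) \<ge> real n * \<mu> + real n * \<delta> n} \<le> real n powr - \<gamma>"
    and "prob {\<omega> \<in> space P. (\<Sum>s\<in>{1..<Suc n}. \<phi> (M s \<omega>)) \<le> real n * \<mu> - real n * \<delta> n} \<le> real n powr - \<gamma>"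
proof -
  let ?I = "Inr ` {1..<Suc n} :: (nat + nat) set"
  interpret H: Hoeffding_ineq_iid P ?I "\<lambda>i \<omega>. \<phi> (case_sum V M i \<omega>)" "\<lambda>\<omega>. \<phi> (M 1 \<omega>)" 0 1 \<mu>
  proof unfold_locales
    show "indep_vars (\<lambda>_. borel) (\<lambda>i \<omega>. \<phi> (case_sum V M i \<omega>)) ?I"
      by (rule indep_vars_compose2[OF indep_vars_subset[OF indep]]) auto
    fix i assume "i \<in> ?I"
    then obtain s where s: "i = Inr s" "s \<ge> 1" by auto
    have "distr P borel (\<lambda>\<omega>. \<phi> (M s \<omega>)) = distr (distr P borel (M s)) borel \<phi>"
      using s by (subst distr_distr) (auto simp: comp_def)
    also have "\<dots> = distr (distr P borel (M 1)) borel \<phi>" by (simp only: M_distr[OF s(2)])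
    also have "\<dots> = distr P borel (\<lambda>\<omega>. \<phi> (M 1 \<omega>))" by (subst distr_distr) (auto simp: comp_def)
    finally show "distr P borel (\<lambda>\<omega>. \<phi> (case_sum V M i \<omega>)) = distr P borel (\<lambda>\<omega>. \<phi> (M 1 \<omega>))"
      by (simp add: s)
  next
    show "AE \<omega> in P. \<phi> (M 1 \<omega>) \<in> {0..1}" using \<phi>01 by blast
    show "(\<lambda>\<omega>. \<phi> (M 1 \<omega>)) \<in> borel_measurable P" by measurable
  qed (auto simp: \<mu>_def)
  have card: "card ?I = n" by (simp add: card_image)
  have sum: "(\<Sum>i\<in>?I. \<phi> (case_sum V M i \<omega>)) = (\<Sum>s\<in>{1..<Suc n}. \<phi> (M s \<omega>))" for \<omega>
    by (subst sum.reindex) auto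
  have ne: "?I \<noteq> {}" using n by auto
  have d: "0 \<le> real n * \<delta> n" using \<delta>_nonneg by simp
  have "exp (- 2 * (real n * \<delta> n)\<^sup>2 / (real n * (1 - 0)\<^sup>2)) = exp (- (\<gamma> * ln (real n)))"
    using n by (simp add: power_mult_distrib \<delta>_sq) (simp add: power2_eq_square)
  then have e: "exp (- 2 * (real n * \<delta> n)\<^sup>2 / (real n * (1 - 0)\<^sup>2)) = real n powr - \<gamma>"
    using n by (simp add: exp_gamma_ln)
  show "prob {\<omega> \<in> space P. (\<Sum>s\<in>{1..<Suc n}. \<phi> (M s \<omega>)) \<ge> real n * \<mu> + real n * \<delta> n} \<le> real n powr - \<gamma>"
    using H.Hoeffding_ineq_ge[OF d _ ne] unfolding card sum e by simp
  show "prob {\<omega> \<in> space P. (\<Sum>s\<in>{1..<Suc n}. \<phi> (M s \<omega>)) \<le> real n * \<mu> - real n * \<delta> n} \<le> real n powr - \<gamma>"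
    using H.Hoeffding_ineq_le[OF d _ ne] unfolding card sum e by simp
qed

text \<open>One-sided uniform control of the empirical distribution function by a grid in the values of
  \<open>F\<close>, which avoids any continuity assumption on \<open>F\<close>.\<close>

definition grid_ok :: "nat \<Rightarrow> 'a \<Rightarrow> bool" where
  "grid_ok n \<omega> \<longleftrightarrow> (\<forall>j\<in>{1..n}. (\<Sum>s\<in>{1..<Suc n}. if F (M s \<omega>) < real j / real n then 1 else 0) \<le> real j + real n * \<delta> n)"

lemma grid_ok_measurable [measurable]: "Measurable.pred P (grid_ok n)"
  unfolding grid_ok_def by measurable

text \<open>A competing bid at most \<open>b\<close> has \<open>F\<close>-value at most
  \<open>F b\<close>, so the count at \<open>b\<close> is dominated by the count at the next grid
  level. Rounding up to the grid costs \<open>1 / n\<close>.\<close>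

lemma fhat_le_of_grid_ok:
  assumes n: "n \<ge> 1" and g: "grid_ok n \<omega>"
  shows "fhat (Suc n) \<omega> b \<le> F b + \<delta> n + 1 / real n"
\<comment> \<open>For \<open>F b = 1\<close> the next level would be \<open>n + 1\<close>, outside
  the grid, but then the trivial bound 1 suffices.\<close>
proof (cases "F b = 1")
  case True
  have "card {s \<in> {1..<Suc n}. M s \<omega> \<le> b} \<le> card {1..<Suc n}" by (intro card_mono) auto
  then have "fhat (Suc n) \<omega> b \<le> 1" using n by (simp add: fhat_def Fhat_def)
  then show ?thesis using True \<delta>_nonneg[of n] by (simp add: add_nonneg_nonneg add_increasing2)
next
  case False
  with F01[of b] have F: "0 \<le> F b" "F b < 1" by auto
  define j where "j = nat \<lfloor>F b * real n\<rfloor> + 1"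
  have "real_of_int \<lfloor>F b * real n\<rfloor> = real (nat \<lfloor>F b * real n\<rfloor>)"
    using F by simp
  moreover have "F b * real n < real n" using F n by simp
  ultimately have j: "F b * real n < real j" "real j \<le> F b * real n + 1" "j \<in> {1..n}"
    unfolding j_def by (simp_all, linarith+)
  have "real (card {s \<in> {1..<Suc n}. M s \<omega> \<le> b}) = (\<Sum>s\<in>{1..<Suc n}. if M s \<omega> \<le> b then 1 else 0)"
    by (rule real_card_eq_sum) simp
  also have "\<dots> \<le> (\<Sum>s\<in>{1..<Suc n}. if F (M s \<omega>) < real j / real n then 1 else 0)"
  proof (intro sum_mono)
    fix s
    have "F (M s \<omega>) < real j / real n" if "M s \<omega> \<le> b"
    proof -
      have "F (M s \<omega>) \<le> F b" by (rule monoD[OF F_mono that])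
      also have "\<dots> < real j / real n" using j n by (simp add: field_simps)
      finally show ?thesis .
    qed
    then show "(if M s \<omega> \<le> b then 1 else 0 :: real) \<le> (if F (M s \<omega>) < real j / real n then 1 else 0)" by auto
  qed
  also have "\<dots> \<le> real j + real n * \<delta> n" using g j(3) unfolding grid_ok_def by blast
  finally have "real (card {s \<in> {1..<Suc n}. M s \<omega> \<le> b}) \<le> F b * real n + 1 + real n * \<delta> n" using j(2) by simp
  then have "real (card {s \<in> {1..<Suc n}. M s \<omega> \<le> b}) / real n \<le> (F b * real n + 1 + real n * \<delta> n) / real n"
    using n by (intro divide_right_mono) auto
  also have "\<dots> = F b + \<delta> n + 1 / real n" using n by (simp add: field_simps)
  finally show ?thesis by (simp add: fhat_def Fhat_def)
qed

text \<open>By \<open>measure_cdf_less_le\<close> the expected count at level \<open>j\<close> is at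
  most \<open>j\<close>, so a failure at that level is a Hoeffding deviation; the \<open>n\<close>
  levels are combined by a union bound.\<close>

lemma prob_not_grid_ok:
  assumes n: "n \<ge> 1"
  shows "prob {\<omega> \<in> space P. \<not> grid_ok n \<omega>} \<le> real n powr (1 - \<gamma>)"
proof -
  define \<phi> where "\<phi> j x = (if F x < real j / real n then 1 else 0 :: real)" for j x
  have [measurable]: "\<phi> j \<in> borel_measurable borel" for j unfolding \<phi>_def by measurable
  have mean: "expectation (\<lambda>\<omega>. \<phi> j (M 1 \<omega>)) \<le> real j / real n" for j
  proof -
    have "expectation (\<lambda>\<omega>. \<phi> j (M 1 \<omega>)) = (\<integral>x. \<phi> j x \<partial>distr P borel (M 1))"
      by (subst integral_distr) auto
    also have "\<dots> = (\<integral>x. indicator {x. F x < real j / real n} x \<partial>distr P borel (M 1))"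
      by (intro Bochner_Integration.integral_cong) (auto simp: \<phi>_def indicator_def)
    also have "\<dots> = measure (distr P borel (M 1)) {x. F x < real j / real n}" by simp
    also have "\<dots> \<le> real j / real n"
      unfolding F_eq_cdf by (rule MD.measure_cdf_less_le) simp
    finally show ?thesis .
  qed
  define A where "A j = {\<omega> \<in> space P. (\<Sum>s\<in>{1..<Suc n}. \<phi> j (M s \<omega>)) \<ge>
    real n * expectation (\<lambda>\<omega>. \<phi> j (M 1 \<omega>)) + real n * \<delta> n}" for j
  have [measurable]: "A j \<in> events" for j unfolding A_def by measurable
  have "{\<omega> \<in> space P. \<not> grid_ok n \<omega>} \<subseteq> (\<Union>j\<in>{1..n}. A j)"
  proof safe
    fix \<omega> assume w: "\<omega> \<in> space P" "\<not> grid_ok n \<omega>"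
    then obtain j where j: "j \<in> {1..n}" "(\<Sum>s\<in>{1..<Suc n}. \<phi> j (M s \<omega>)) > real j + real n * \<delta> n"
      unfolding grid_ok_def \<phi>_def by (auto simp: not_le)
    have "real n * expectation (\<lambda>\<omega>. \<phi> j (M 1 \<omega>)) \<le> real n * (real j / real n)"
      by (intro mult_left_mono mean) auto
    then have "real n * expectation (\<lambda>\<omega>. \<phi> j (M 1 \<omega>)) \<le> real j" using n by simp
    with j w(1) have "\<omega> \<in> A j" by (simp add: A_def)
    with j show "\<omega> \<in> (\<Union>j\<in>{1..n}. A j)" by blast
  qed
  then have "prob {\<omega> \<in> space P. \<not> grid_ok n \<omega>} \<le> prob (\<Union>j\<in>{1..n}. A j)"
    by (intro finite_measure_mono) auto
  also have "\<dots> \<le> (\<Sum>j\<in>{1..n}. prob (A j))" by (intro measure_UNION_le) auto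
  also have "\<dots> \<le> (\<Sum>j\<in>{1..n}. real n powr - \<gamma>)"
    unfolding A_def by (intro sum_mono prob_M_deviation(1) n) (auto simp: \<phi>_def)
  also have "\<dots> = real n powr (1 - \<gamma>)" using n by (simp add: powr_diff powr_minus divide_simps)
  finally show ?thesis .
qed

text \<open>The upper bound on the empirical distribution function is used at the random bid and so
  has to be uniform. The lower bound is used only at the fixed point
  \<open>bstar v F\<close>.\<close>

definition good :: "nat \<Rightarrow> 'a \<Rightarrow> bool" where
  "good n \<omega> \<longleftrightarrow> \<bar>vhat (Suc n) \<omega> - v\<bar> \<le> radius (Suc n) \<omega> \<and> grid_ok n \<omega> \<and>
     F (bstar v F) - \<delta> n \<le> fhat (Suc n) \<omega> (bstar v F)"

lemma good_measurable [measurable]: "Measurable.pred P (good n)"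
  unfolding good_def by measurable

lemma prob_not_good:
  assumes n: "n \<ge> 1"
  shows "prob {\<omega> \<in> space P. \<not> good n \<omega>} \<le> 4 * real n powr (1 - \<gamma>)"
proof -
  let ?b = "bstar v F"
  define A1 where "A1 = {\<omega> \<in> space P. radius (Suc n) \<omega> < \<bar>vhat (Suc n) \<omega> - v\<bar>}"
  define A2 where "A2 = {\<omega> \<in> space P. \<not> grid_ok n \<omega>}"
  define A3 where "A3 = {\<omega> \<in> space P. (\<Sum>s\<in>{1..<Suc n}. if M s \<omega> \<le> ?b then 1 else 0) \<le> real n * F ?b - real n * \<delta> n}"
  have [measurable]: "A1 \<in> events" "A2 \<in> events" unfolding A1_def A2_def by measurable
  have [measurable]: "A3 \<in> events" unfolding A3_def by measurable
  have "prob A3 \<le> real n powr - \<gamma>"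
    using prob_M_deviation(2)[OF n, of "\<lambda>x. if x \<le> ?b then 1 else 0"]
    by (simp add: A3_def expectation_M_le)
  also have "\<dots> \<le> real n powr (1 - \<gamma>)" using n by (intro powr_mono) auto
  finally have 3: "prob A3 \<le> real n powr (1 - \<gamma>)" .
  have "{\<omega> \<in> space P. \<not> good n \<omega>} \<subseteq> (A1 \<union> A2) \<union> A3"
  proof -
    have "\<omega> \<in> A3" if "\<omega> \<in> space P" "fhat (Suc n) \<omega> ?b < F ?b - \<delta> n" for \<omega>
      using that n by (auto simp: A3_def fhat_def Fhat_eq_sum field_simps)
    then show ?thesis by (auto simp: good_def A1_def A2_def not_le)
  qed
  then have "prob {\<omega> \<in> space P. \<not> good n \<omega>} \<le> prob ((A1 \<union> A2) \<union> A3)" by (intro finite_measure_mono) auto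
  also have "\<dots> \<le> prob (A1 \<union> A2) + prob A3" by (intro measure_Un_le) auto
  also have "\<dots> \<le> prob A1 + prob A2 + prob A3" by (intro add_right_mono measure_Un_le) auto
  also have "\<dots> \<le> 4 * real n powr (1 - \<gamma>)"
    using 3 prob_value_deviation[OF n] prob_not_grid_ok[OF n] by (simp add: A1_def A2_def)
  finally show ?thesis .
qed

text \<open>A Chernoff bound for wins against their conditional probabilities. The parameter
  \<open>4 * x\<close> maximises \<open>l * n * x - l\<^sup>2 * n / 8\<close>, with value
  \<open>2 * n * x\<^sup>2\<close>.\<close>

lemma prob_wins_deviation:
  assumes n: "n \<ge> 1" and x: "x \<ge> 0"
  shows "prob {\<omega> \<in> space P. (\<Sum>s\<in>{1..<Suc n}. F (bid s \<omega>)) - real (nwins (Suc n) \<omega>) \<ge> real n * x}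
    \<le> exp (- (2 * real n * x\<^sup>2))"
proof -
  define D where "D \<omega> = (\<Sum>s\<in>{1..<Suc n}. F (bid s \<omega>)) - real (nwins (Suc n) \<omega>)" for \<omega>
  have [measurable]: "D \<in> borel_measurable P" unfolding D_def by measurable
  have expo: "win_exponent (4 * x) (Suc n) (\<lambda>s. V s \<omega>) (\<lambda>s. M s \<omega>) = 4 * x * D \<omega> - 2 * x\<^sup>2 * real n" for \<omega>
    unfolding win_exponent_def bid_def[symmetric] D_def nwins_eq_sum sum_subtractf
      sum_distrib_left[symmetric] by (simp add: power_mult_distrib)
  have "prob {\<omega> \<in> space P. D \<omega> \<ge> real n * x} \<le> exp (- (2 * real n * x\<^sup>2))"
  proof (rule prob_le_exp_of_nn_integral_exp_le_1)
    show "(\<integral>\<^sup>+\<omega>. ennreal (exp (4 * x * D \<omega> - 2 * x\<^sup>2 * real n)) \<partial>P) \<le> 1"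
      using nn_integral_exp_win_exponent[of "Suc n" "4 * x"] by (simp add: expo)
    fix \<omega> assume "\<omega> \<in> {\<omega> \<in> space P. D \<omega> \<ge> real n * x}"
    then have "4 * x * (real n * x) \<le> 4 * x * D \<omega>" using x by (intro mult_left_mono) auto
    then show "2 * real n * x\<^sup>2 \<le> 4 * x * D \<omega> - 2 * x\<^sup>2 * real n" by (simp add: power2_eq_square mult_ac)
  qed auto
  then show ?thesis by (simp add: D_def)
qed

end

subsection \<open>Regret\<close>

context ucbid_auction
begin

abbreviation "U \<equiv> util v F"
abbreviation "bs \<equiv> bstar v F"

text \<open>Since \<open>(v - b) * F b \<le> v * F b\<close> for \<open>b \<ge> 0\<close>, this
  ratio is a lower bound for the winning probability of the optimal bid, and it remains one, up to
  errors, for optimistic bids.\<close>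

definition p :: real where "p = U bs / v"

lemma v_pos: "v > 0"
proof -
  have "0 < (v - bs) * F bs" using opt_pos by (simp add: util_def)
  then have "v - bs > 0" using F01[of bs] by (simp add: zero_less_mult_iff)
  then show ?thesis using bstar01 by simp
qed

lemma bs_less_v: "bs < v"
  using opt_pos F01[of bs] by (auto simp: util_def zero_less_mult_iff)

lemma p_pos: "p > 0"
  using v_pos opt_pos by (simp add: p_def)

lemma p_le_F: "p \<le> F bs"
proof -
  have "(v - bs) * F bs \<le> v * F bs" using bstar01 F01[of bs] by (intro mult_right_mono) auto
  then show ?thesis using v_pos by (simp add: p_def util_def field_simps)
qed

lemma p_le_1: "p \<le> 1"
  using p_le_F F01[of bs] by simp

lemma U_abs_le: "b \<in> {0..1} \<Longrightarrow> \<bar>U b\<bar> \<le> 1"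
proof -
  assume b: "b \<in> {0..1}"
  have "\<bar>v - b\<bar> * \<bar>F b\<bar> \<le> 1 * 1" using b v01 F01[of b] by (intro mult_mono) auto
  then show ?thesis by (simp add: util_def abs_mult)
qed

text \<open>Optimism: in a good round the index \<open>c\<close> satisfies
  \<open>v \<le> c \<le> v + 2 * r\<close> with the radius \<open>r\<close>. Optimality of the bid
  for \<open>c\<close> and the empirical distribution function is transferred to \<open>v\<close>
  and \<open>F\<close>, each replacement costing its estimation error.\<close>

lemma
  assumes n: "n \<ge> 1" and w: "\<omega> \<in> space P" and g: "good n \<omega>" and small: "2 * \<delta> n + 1 / real n \<le> p / 2"
  shows F_bid_ge: "F (bid (Suc n) \<omega>) \<ge> p / 2"
    and regret_le: "U bs - U (bid (Suc n) \<omega>) \<le>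
      (v + 2 * radius (Suc n) \<omega>) * (2 * \<delta> n + 1 / real n) + 2 * radius (Suc n) \<omega>"
proof -
  let ?B = "bid (Suc n) \<omega>" and ?Fh = "fhat (Suc n) \<omega>" and ?r = "radius (Suc n) \<omega>"
  define c where "c = vhat (Suc n) \<omega> + ?r"
  from g have c: "v \<le> c" "c \<le> v + 2 * ?r" and gr: "grid_ok n \<omega>" and Fb: "F bs - \<delta> n \<le> ?Fh bs"
    unfolding good_def c_def by auto
  have dn: "\<delta> n \<ge> 0" by (rule \<delta>_nonneg)
  have up: "?Fh b \<le> F b + \<delta> n + 1 / real n" for b by (rule fhat_le_of_grid_ok[OF n gr])
  have "\<delta> n < p"
  proof -
    have "1 / real n > 0" using n by simp
    then show ?thesis using small dn p_pos by linarith
  qed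
  then have Fpos: "?Fh bs > 0" using Fb p_le_F by linarith
  have obj: "ucb_obj \<gamma> (\<lambda>s. V s \<omega>) (\<lambda>s. M s \<omega>) (Suc n) b = (c - b) * ?Fh b" for b
    by (simp add: ucb_obj_def ucb_index_def c_def vhat_def radius_def fhat_def bid_def)
  have cb: "c - bs > 0" using c bs_less_v by simp
  \<comment> \<open>The objective is positive at \<open>bs\<close>, which ensures that the bid,
    defined as a supremum, really is a maximiser.\<close>
  have opt: "(c - bs) * ?Fh bs \<le> (c - ?B) * ?Fh ?B"
    unfolding obj[symmetric] unfolding bid_def
    by (rule ucbid_optimal[of \<gamma> "Suc n" _ _ bs])
       (use gamma n w V01 M01 bstar01 cb Fpos in \<open>auto simp: obj\<close>)
  have Fh0: "?Fh b \<ge> 0" for b by (simp add: fhat_def Fhat_def)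
  have pos: "(c - bs) * ?Fh bs > 0" using cb Fpos by simp
  have cB: "c - ?B > 0" using opt pos Fh0[of ?B]
    by (meson less_le_trans mult_nonpos_nonneg not_less)
  have B01: "?B \<in> {0..1}" by (rule bid01) (use w in auto)
  have "p - \<delta> n \<le> (v - bs) / v * ?Fh bs"
  proof -
    have q: "0 \<le> (v - bs) / v" "(v - bs) / v \<le> 1" using v_pos bs_less_v bstar01 by auto
    have "p - \<delta> n \<le> (v - bs) / v * F bs - (v - bs) / v * \<delta> n"
      using mult_right_mono[OF q(2) dn] by (simp add: p_def util_def)
    also have "\<dots> = (v - bs) / v * (F bs - \<delta> n)" by (simp add: algebra_simps)
    also have "\<dots> \<le> (v - bs) / v * ?Fh bs" by (intro mult_left_mono Fb q)
    finally show ?thesis .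
  qed
  \<comment> \<open>The fraction \<open>1 - bs / c\<close> increases with \<open>c\<close>, so
    overestimating the value does not weaken the lower bound on the chance of winning.\<close>
  also have "\<dots> \<le> (c - bs) / c * ?Fh bs"
  proof (intro mult_right_mono)
    have "bs / c \<le> bs / v" using c v_pos bstar01 by (intro divide_left_mono) auto
    then show "(v - bs) / v \<le> (c - bs) / c" using c v_pos by (simp add: diff_divide_distrib)
  qed (use Fpos in auto)
  also have "\<dots> \<le> ?Fh ?B"
  proof -
    have "(c - ?B) * ?Fh ?B \<le> c * ?Fh ?B" using B01 Fh0 by (intro mult_right_mono) auto
    with opt have "(c - bs) * ?Fh bs \<le> c * ?Fh ?B" by linarith
    then show ?thesis using c v_pos by (simp add: field_simps)
  qed
  finally have "p - \<delta> n \<le> ?Fh ?B" .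
  with up[of ?B] small show "F ?B \<ge> p / 2" by linarith
  \<comment> \<open>Passing from value \<open>v\<close> to \<open>c\<close> leaves
    \<open>(c - v) * (F ?B - F bs)\<close>, at most twice the radius. The remaining difference only
    compares \<open>F\<close> with its empirical version at the two bids.\<close>
  have "U bs - U ?B = (c - bs) * F bs - (c - ?B) * F ?B + (c - v) * (F ?B - F bs)"
    by (simp add: util_def algebra_simps)
  also have "(c - bs) * F bs \<le> (c - bs) * ?Fh bs + (c - bs) * \<delta> n"
    using mult_left_mono[of "F bs" "?Fh bs + \<delta> n" "c - bs"] Fb cb by (simp add: algebra_simps)
  also have "(c - bs) * \<delta> n \<le> c * \<delta> n" using bstar01 dn by (intro mult_right_mono) auto
  also have "(c - bs) * ?Fh bs \<le> (c - ?B) * ?Fh ?B" by (rule opt)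
  also have "(c - ?B) * ?Fh ?B \<le> (c - ?B) * F ?B + (c - ?B) * (\<delta> n + 1 / real n)"
    using mult_left_mono[OF up[of ?B], of "c - ?B"] cB by (simp add: algebra_simps)
  also have "(c - ?B) * (\<delta> n + 1 / real n) \<le> c * (\<delta> n + 1 / real n)"
    using B01 dn by (intro mult_right_mono) auto
  also have "(c - v) * (F ?B - F bs) \<le> (c - v) * 1"
    using c F01[of ?B] F01[of bs] by (intro mult_left_mono) auto
  finally have "U bs - U ?B \<le> c * (2 * \<delta> n + 1 / real n) + (c - v)"
    by (simp add: algebra_simps)
  also have "c * (2 * \<delta> n + 1 / real n) \<le> (v + 2 * ?r) * (2 * \<delta> n + 1 / real n)"
    using c dn by (intro mult_right_mono) auto
  finally show "U bs - U ?B \<le> (v + 2 * ?r) * (2 * \<delta> n + 1 / real n) + 2 * ?r" using c by simp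
qed

lemma ln_over_n_tendsto: "(\<lambda>n. ln (real n) / real n) \<longlonglongrightarrow> 0"
  using filterlim_compose[OF ln_x_over_x_tendsto_0 filterlim_real_sequentially] .

lemma sqrt_ln_over_n_tendsto: "(\<lambda>n. sqrt (k * (ln (real n) / real n))) \<longlonglongrightarrow> 0"
  using tendsto_real_sqrt[OF tendsto_mult[OF tendsto_const ln_over_n_tendsto, of k]] by simp

lemma \<delta>_eq: "\<delta> n = sqrt (\<gamma> / 2 * (ln (real n) / real n))"
  by (simp add: \<delta>_def)

lemma eventually_small: "eventually (\<lambda>n. 2 * \<delta> n + 1 / real n \<le> p / 2) sequentially"
proof -
  have "(\<lambda>n. 2 * \<delta> n + 1 / real n) \<longlonglongrightarrow> 2 * 0 + 0"
    unfolding \<delta>_eq by (intro tendsto_intros sqrt_ln_over_n_tendsto lim_1_over_n)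
  then have "eventually (\<lambda>n. 2 * \<delta> n + 1 / real n < p / 2) sequentially"
    using p_pos by (intro order_tendstoD(2)) auto
  then show ?thesis by eventually_elim simp
qed

text \<open>Here \<open>\<gamma> > 2\<close> enters: the exponent is below -1.\<close>

lemma bad_summable: "summable (\<lambda>n. real n powr (1 - \<gamma>))"
  using gamma by (subst summable_real_powr_iff) auto

text \<open>If round \<open>k + 1\<close> is good, then it is won with probability at least \<open>p / 2\<close>. The expected
  number of bad rounds is finite, so Markov's inequality loses only a factor of order \<open>1 / n\<close>,
  which sums to a logarithm.\<close>

lemma prob_few_wins:
  obtains C where "C \<ge> 0"
    "\<And>n. n \<ge> 1 \<Longrightarrow> prob {\<omega> \<in> space P. real (nwins (Suc n) \<omega>) < p * real n / 4} \<le> C / real n"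
proof -
  obtain n0 where n0: "n0 \<ge> 1" "\<And>n. n \<ge> n0 \<Longrightarrow> 2 * \<delta> n + 1 / real n \<le> p / 2"
  proof -
    from eventually_small obtain N where "\<And>n. n \<ge> N \<Longrightarrow> 2 * \<delta> n + 1 / real n \<le> p / 2"
      unfolding eventually_sequentially by blast
    then show ?thesis by (intro that[of "max 1 N"]) auto
  qed
  define Z where "Z = (\<Sum>n. real n powr (1 - \<gamma>))"
  have Z0: "Z \<ge> 0" unfolding Z_def by (intro suminf_nonneg bad_summable) auto
  \<comment> \<open>The terms come from Markov's inequality for the bad rounds, from the deviation
    of the wins, and from the trivial bound when \<open>n < 8 * n0\<close>.\<close>
  define C where "C = 32 * Z + 32 / p\<^sup>2 + 8 * real n0"
  have C0: "C \<ge> 0" using Z0 by (simp add: C_def)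
  have "prob {\<omega> \<in> space P. real (nwins (Suc n) \<omega>) < p * real n / 4} \<le> C / real n" if n: "n \<ge> 1" for n
  proof (cases "n \<ge> 8 * n0")
    case False
    have "prob {\<omega> \<in> space P. real (nwins (Suc n) \<omega>) < p * real n / 4} \<le> 1" by simp
    also have "\<dots> \<le> 8 * real n0 / real n" using False n by (simp add: field_simps)
    also have "\<dots> \<le> C / real n" using Z0 n by (intro divide_right_mono) (auto simp: C_def)
    finally show ?thesis .
  next
    case True
    define L where "L \<omega> = (\<Sum>k\<in>{n0..<n}. indicator {\<omega> \<in> space P. \<not> good k \<omega>} \<omega> :: real)" for \<omega>
    have [measurable]: "L \<in> borel_measurable P" unfolding L_def by measurable
    have I_int: "integrable P (indicat_real {\<omega> \<in> space P. \<not> good k \<omega>})" for k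
    proof (rule integrable_real_indicator)
      show "{\<omega> \<in> space P. \<not> good k \<omega>} \<in> events" by measurable
    qed (simp add: emeasure_eq_measure)
    have L_int: "integrable P L" unfolding L_def by (intro Bochner_Integration.integrable_sum I_int)
    have L0: "L \<omega> \<ge> 0" for \<omega> unfolding L_def by (intro sum_nonneg) auto
    have "expectation L = (\<Sum>k\<in>{n0..<n}. prob {\<omega> \<in> space P. \<not> good k \<omega>})"
      unfolding L_def by (subst Bochner_Integration.integral_sum[OF I_int]) auto
    also have "\<dots> \<le> (\<Sum>k\<in>{n0..<n}. 4 * real k powr (1 - \<gamma>))"
      using n0 by (intro sum_mono prob_not_good) auto
    also have "\<dots> \<le> 4 * Z" unfolding Z_def sum_distrib_left[symmetric]
      by (intro mult_left_mono sum_le_suminf bad_summable) auto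
    finally have EL: "expectation L \<le> 4 * Z" .
    define A where "A = {\<omega> \<in> space P. L \<omega> \<ge> real n / 8}"
    define D where "D = {\<omega> \<in> space P. (\<Sum>s\<in>{1..<Suc n}. F (bid s \<omega>)) - real (nwins (Suc n) \<omega>) \<ge> real n * (p / 8)}"
    have [measurable]: "A \<in> events" "D \<in> events" unfolding A_def D_def by measurable
    have "prob A \<le> expectation L / (real n / 8)"
      unfolding A_def using n L0 by (intro integral_Markov_inequality_measure[OF L_int sets.top]) auto
    also have "\<dots> \<le> 4 * Z / (real n / 8)" using EL n by (intro divide_right_mono) auto
    finally have PA: "prob A \<le> 32 * Z / real n" by simp
    have "prob D \<le> exp (- (2 * real n * (p / 8)\<^sup>2))"
      unfolding D_def using n p_pos by (intro prob_wins_deviation) auto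
    \<comment> \<open>The exponential is weakened by \<open>exp (- x) \<le> 1 / x\<close>, since the
      Markov bound is only of order \<open>1 / n\<close> anyway.\<close>
    also have "\<dots> \<le> 1 / (2 * real n * (p / 8)\<^sup>2)"
    proof -
      have x: "2 * real n * (p / 8)\<^sup>2 > 0" using n p_pos by simp
      have "2 * real n * (p / 8)\<^sup>2 \<le> exp (2 * real n * (p / 8)\<^sup>2)"
        using exp_ge_add_one_self[of "2 * real n * (p / 8)\<^sup>2"] by linarith
      then show ?thesis using x by (simp add: exp_minus divide_simps)
    qed
    also have "\<dots> = 32 / p\<^sup>2 / real n" by (simp add: power_divide)
    finally have PD: "prob D \<le> 32 / p\<^sup>2 / real n" .
    have "{\<omega> \<in> space P. real (nwins (Suc n) \<omega>) < p * real n / 4} \<subseteq> A \<union> D"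
    proof (rule subsetI, rule ccontr)
      fix \<omega> assume "\<omega> \<in> {\<omega> \<in> space P. real (nwins (Suc n) \<omega>) < p * real n / 4}" "\<omega> \<notin> A \<union> D"
      then have w: "\<omega> \<in> space P" and few: "real (nwins (Suc n) \<omega>) < p * real n / 4"
        and L: "L \<omega> < real n / 8" and D: "(\<Sum>s\<in>{1..<Suc n}. F (bid s \<omega>)) < real (nwins (Suc n) \<omega>) + real n * (p / 8)"
        by (auto simp: A_def D_def not_le)
      \<comment> \<open>At most \<open>n / 8\<close> rounds precede \<open>n0\<close> and fewer than
        \<open>n / 8\<close> are bad, which leaves \<open>3 / 4 * n\<close> rounds won with
        probability at least \<open>p / 2\<close>. The total \<open>3 / 8 * p * n\<close> exceeds
        the assumed wins by the slack \<open>p * n / 8\<close> in \<open>D\<close>.\<close>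
      have "p / 2 * (3 / 4 * real n) \<le> p / 2 * (real (n - n0) - L \<omega>)"
        using L True p_pos by (intro mult_left_mono) auto
      also have "\<dots> = (\<Sum>k\<in>{n0..<n}. p / 2 * (1 - indicator {\<omega> \<in> space P. \<not> good k \<omega>} \<omega>))"
        unfolding L_def sum_distrib_left[symmetric] sum_subtractf by simp
      also have "\<dots> \<le> (\<Sum>k\<in>{n0..<n}. F (bid (Suc k) \<omega>))"
      proof (intro sum_mono)
        fix k assume k: "k \<in> {n0..<n}"
        show "p / 2 * (1 - indicator {\<omega> \<in> space P. \<not> good k \<omega>} \<omega>) \<le> F (bid (Suc k) \<omega>)"
        proof (cases "good k \<omega>")
          case True
          then show ?thesis using F_bid_ge[of k \<omega>] k n0 w by auto
        next
          case False
          then show ?thesis using w F01 by simp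
        qed
      qed
      also have "\<dots> = (\<Sum>s\<in>{Suc n0..<Suc n}. F (bid s \<omega>))"
        by (rule sum.shift_bounds_Suc_ivl[symmetric])
      also have "\<dots> \<le> (\<Sum>s\<in>{1..<Suc n}. F (bid s \<omega>))"
        using F01 by (intro sum_mono2) auto
      finally have "3 / 8 * (p * real n) \<le> (\<Sum>s\<in>{1..<Suc n}. F (bid s \<omega>))" by simp
      moreover have "real n * (p / 8) = p * real n / 8" by simp
      ultimately show False using D few by linarith
    qed
    then have "prob {\<omega> \<in> space P. real (nwins (Suc n) \<omega>) < p * real n / 4} \<le> prob (A \<union> D)"
      by (intro finite_measure_mono) auto
    also have "\<dots> \<le> prob A + prob D" by (intro measure_Un_le) auto
    also have "\<dots> \<le> 32 * Z / real n + 32 / p\<^sup>2 / real n" using PA PD by simp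
    also have "\<dots> \<le> C / real n" using n by (simp add: C_def add_divide_distrib)
    finally show ?thesis .
  qed
  with C0 that show ?thesis by blast
qed

lemma U_bid_integrable: "t \<ge> 1 \<Longrightarrow> integrable P (\<lambda>\<omega>. U (bid t \<omega>))"
proof (rule integrable_bounded_rv[where k = 1])
  assume [measurable]: "t \<ge> 1"
  show "(\<lambda>\<omega>. U (bid t \<omega>)) \<in> borel_measurable P" unfolding util_def by measurable
qed (use bid01 U_abs_le in blast)

lemma expected_regret_le_2: "t \<ge> 1 \<Longrightarrow> U bs - expectation (\<lambda>\<omega>. U (bid t \<omega>)) \<le> 2"
proof -
  assume t: "t \<ge> 1"
  have "expectation (\<lambda>_. -1) \<le> expectation (\<lambda>\<omega>. U (bid t \<omega>))"
  proof (rule integral_mono)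
    fix \<omega> assume "\<omega> \<in> space P"
    then have "\<bar>U (bid t \<omega>)\<bar> \<le> 1" using bid01[OF t] by (intro U_abs_le) auto
    then show "-1 \<le> U (bid t \<omega>)" by simp
  qed (use U_bid_integrable[OF t] in auto)
  moreover have "U bs \<le> 1" using U_abs_le[OF bstar01] by simp
  ultimately show ?thesis by (simp add: prob_space)
qed

lemma expected_regret_le:
  obtains K where "K \<ge> 0" "\<And>n. n \<ge> 1 \<Longrightarrow> U bs - expectation (\<lambda>\<omega>. U (bid (Suc n) \<omega>)) \<le>
    6 * (sqrt (\<gamma> / p) * sqrt (ln (real n) / real n)) + K / real n + 8 * real n powr (1 - \<gamma>)"
proof -
  obtain C where C: "C \<ge> 0"
    "\<And>n. n \<ge> 1 \<Longrightarrow> prob {\<omega> \<in> space P. real (nwins (Suc n) \<omega>) < p * real n / 4} \<le> C / real n"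
    using prob_few_wins by blast
  define q where "q n = sqrt (\<gamma> / p) * sqrt (ln (real n) / real n)" for n
  have q_eq: "q n = sqrt (\<gamma> / p * (ln (real n) / real n))" for n
    unfolding q_def real_sqrt_mult[symmetric] ..
  have "eventually (\<lambda>n. q n < 1 / 6) sequentially"
    unfolding q_eq by (intro order_tendstoD(2)[OF sqrt_ln_over_n_tendsto]) auto
  with eventually_small have "eventually (\<lambda>n. 2 * \<delta> n + 1 / real n \<le> p / 2 \<and> q n < 1 / 6) sequentially"
    by eventually_elim simp
  then obtain n1 where n1: "\<And>n. n \<ge> n1 \<Longrightarrow> 2 * \<delta> n + 1 / real n \<le> p / 2 \<and> q n < 1 / 6"
    unfolding eventually_sequentially by blast
  \<comment> \<open>3/2 covers the grid rounding, \<open>2 * C\<close> the rounds with few wins,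
    each costing at most 2, and \<open>2 * real n1\<close> the early rounds.\<close>
  define K where "K = 3 / 2 + 2 * C + 2 * real n1"
  have q0: "q n \<ge> 0" if "n \<ge> 1" for n using that gamma p_pos by (simp add: q_def)
  have "U bs - expectation (\<lambda>\<omega>. U (bid (Suc n) \<omega>)) \<le> 6 * q n + K / real n + 8 * real n powr (1 - \<gamma>)"
    if n: "n \<ge> 1" for n
  proof (cases "n \<ge> n1")
    case False
    have "U bs - expectation (\<lambda>\<omega>. U (bid (Suc n) \<omega>)) \<le> 2" by (rule expected_regret_le_2) simp
    also have "\<dots> \<le> 2 * real n1 / real n" using False n by (simp add: field_simps)
    also have "\<dots> \<le> K / real n" using C(1) n by (intro divide_right_mono) (auto simp: K_def)
    also have "\<dots> \<le> 6 * q n + K / real n + 8 * real n powr (1 - \<gamma>)" using q0[OF n] by simp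
    finally show ?thesis .
  next
    case True
    note small = n1[OF True, THEN conjunct1] and qs = n1[OF True, THEN conjunct2]
    have ln0: "ln (real n) / real n \<ge> 0" using n by simp
    \<comment> \<open>Uses \<open>p \<le> 1\<close> and that 3/4 exceeds the square root of
      1/2.\<close>
    have \<delta>q: "\<delta> n \<le> 3 / 4 * q n"
    proof -
      have "\<delta> n \<le> sqrt ((3 / 4)\<^sup>2 * (\<gamma> / p * (ln (real n) / real n)))"
        unfolding \<delta>_eq
      proof (intro real_sqrt_le_mono)
        have "\<gamma> \<le> \<gamma> / p" using p_pos p_le_1 gamma by (simp add: field_simps)
        then have "\<gamma> / 2 \<le> (3 / 4)\<^sup>2 * (\<gamma> / p)" using gamma by (simp add: power2_eq_square)
        then have "\<gamma> / 2 * (ln (real n) / real n) \<le> (3 / 4)\<^sup>2 * (\<gamma> / p) * (ln (real n) / real n)"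
          using ln0 by (rule mult_right_mono)
        then show "\<gamma> / 2 * (ln (real n) / real n) \<le> (3 / 4)\<^sup>2 * (\<gamma> / p * (ln (real n) / real n))"
          by (simp only: mult.assoc)
      qed
      also have "\<dots> = 3 / 4 * q n" unfolding q_eq by (subst real_sqrt_mult) simp
      finally show ?thesis .
    qed
    define bad where "bad = {\<omega> \<in> space P. \<not> good n \<omega>}"
    define few where "few = {\<omega> \<in> space P. real (nwins (Suc n) \<omega>) < p * real n / 4}"
    have [measurable]: "bad \<in> events" "few \<in> events" unfolding bad_def few_def by measurable
    have int[simp]: "integrable P (indicat_real bad)" "integrable P (indicat_real few)"
      by (auto intro!: integrable_real_indicator simp: emeasure_eq_measure)
    have pointwise: "U bs - U (bid (Suc n) \<omega>) \<le>
        6 * q n + 3 / 2 / real n + 2 * indicator bad \<omega> + 2 * indicator few \<omega>" if w: "\<omega> \<in> space P" for \<omega>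
    proof (cases "\<omega> \<in> bad \<or> \<omega> \<in> few")
      case True
      have "U bs \<le> 1" using U_abs_le[OF bstar01] by simp
      moreover have "U (bid (Suc n) \<omega>) \<ge> -1" using U_abs_le[OF bid01[of "Suc n" \<omega>]] w by simp
      moreover have "2 \<le> 2 * indicator bad \<omega> + 2 * (indicator few \<omega> :: real)" using True by (auto simp: indicator_def)
      moreover have "6 * q n + 3 / 2 / real n \<ge> 0" using q0[OF n] by simp
      ultimately show ?thesis by linarith
    next
      case False
      then have g: "good n \<omega>" and N: "p * real n / 4 \<le> real (nwins (Suc n) \<omega>)" using w by (auto simp: bad_def few_def)
      \<comment> \<open>At least \<open>p * n / 4\<close> wins give the factor
        \<open>sqrt 2\<close>, rounded up to 3/2.\<close>
      have r: "radius (Suc n) \<omega> \<le> 3 / 2 * q n"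
      proof -
        have "radius (Suc n) \<omega> = sqrt (\<gamma> * ln (real n) / (2 * real (nwins (Suc n) \<omega>)))"
          by (simp add: radius_def epsb_def nwins_def)
        also have "\<dots> \<le> sqrt ((3 / 2)\<^sup>2 * (\<gamma> / p * (ln (real n) / real n)))"
        proof (intro real_sqrt_le_mono)
          have g0: "\<gamma> * ln (real n) \<ge> 0" using gamma n by simp
          have "\<gamma> * ln (real n) / (2 * real (nwins (Suc n) \<omega>)) \<le> \<gamma> * ln (real n) / (2 * (p * real n / 4))"
            using N n p_pos g0 by (intro frac_le) (auto simp: mult_ac)
          also have "\<dots> = 2 * (\<gamma> / p * (ln (real n) / real n))" using n p_pos by (simp add: field_simps)
          also have "\<dots> \<le> (3 / 2)\<^sup>2 * (\<gamma> / p * (ln (real n) / real n))"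
            using ln0 gamma p_pos by (intro mult_right_mono mult_nonneg_nonneg) (auto simp: power2_eq_square)
          finally show "\<gamma> * ln (real n) / (2 * real (nwins (Suc n) \<omega>)) \<le> (3 / 2)\<^sup>2 * (\<gamma> / p * (ln (real n) / real n))" .
        qed
        also have "\<dots> = 3 / 2 * q n" unfolding q_eq by (subst real_sqrt_mult) simp
        finally show ?thesis .
      qed
      have "U bs - U (bid (Suc n) \<omega>) \<le>
          (v + 2 * radius (Suc n) \<omega>) * (2 * \<delta> n + 1 / real n) + 2 * radius (Suc n) \<omega>"
        by (rule regret_le[OF n w g small])
      \<comment> \<open>From \<open>q n < 1 / 6\<close> the radius is below 1/4, so
        \<open>v + 2 * r \<le> 3 / 2\<close>. The multiples of \<open>q n\<close> then add up to 9/4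
        + 3, which is at most 6.\<close>
      also have "\<dots> \<le> 3 / 2 * (2 * \<delta> n + 1 / real n) + 2 * (3 / 2 * q n)"
        using r qs v01 \<delta>_nonneg[of n] by (intro add_mono mult_right_mono mult_left_mono) auto
      also have "\<dots> \<le> 3 / 2 * (2 * (3 / 4 * q n) + 1 / real n) + 2 * (3 / 2 * q n)"
        using \<delta>q by simp
      also have "\<dots> \<le> 6 * q n + 3 / 2 / real n" using q0[OF n] by simp
      also have "\<dots> \<le> 6 * q n + 3 / 2 / real n + 2 * indicator bad \<omega> + 2 * indicator few \<omega>" by simp
      finally show ?thesis .
    qed
    have "U bs - expectation (\<lambda>\<omega>. U (bid (Suc n) \<omega>)) = expectation (\<lambda>\<omega>. U bs - U (bid (Suc n) \<omega>))"
      using U_bid_integrable[of "Suc n"] by (simp add: prob_space)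
    also have "\<dots> \<le> expectation (\<lambda>\<omega>. 6 * q n + 3 / 2 / real n + 2 * indicator bad \<omega> + 2 * indicator few \<omega>)"
      using U_bid_integrable[of "Suc n"] pointwise by (intro integral_mono) auto
    also have "\<dots> = 6 * q n + 3 / 2 / real n + 2 * prob bad + 2 * prob few"
      by (simp add: prob_space)
    also have "\<dots> \<le> 6 * q n + 3 / 2 / real n + 2 * (4 * real n powr (1 - \<gamma>)) + 2 * (C / real n)"
      unfolding bad_def few_def using C(2)[OF n] prob_not_good[OF n] by simp
    also have "\<dots> \<le> 6 * q n + K / real n + 8 * real n powr (1 - \<gamma>)"
      using n by (simp add: K_def add_divide_distrib)
    finally show ?thesis .
  qed
  moreover have "K \<ge> 0" using C(1) by (simp add: K_def)
  ultimately show ?thesis using that unfolding q_def by blast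
qed

end

section \<open>Elementary sums and the total regret\<close>

lemma sum_inverse_sqrt_le: "(\<Sum>k=1..n. 1 / sqrt (real k)) \<le> 2 * sqrt (real n)"
proof (induction n)
  case (Suc n)
  have "1 / sqrt (real (Suc n)) \<le> 2 * sqrt (real (Suc n)) - 2 * sqrt (real n)"
  proof -
    let ?a = "sqrt (real (Suc n))" and ?b = "sqrt (real n)"
    have "?a > 0" by simp
    \<comment> \<open>Here \<open>?b\<^sup>2 = ?a\<^sup>2 - 1\<close>, which turns this inequality
      into the telescoping bound.\<close>
    have "2 * ?a * ?b \<le> ?a\<^sup>2 + ?b\<^sup>2" by (rule sum_squares_bound)
    then have "1 \<le> (2 * ?a - 2 * ?b) * ?a" by (simp add: algebra_simps power2_eq_square)
    then show ?thesis using \<open>?a > 0\<close> by (simp add: divide_le_eq)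
  qed
  with Suc show ?case by simp
qed simp

text \<open>The harmonic sum minus the logarithm is decreasing and starts at 1.\<close>

lemma sum_inverse_le_ln: "n \<ge> 1 \<Longrightarrow> (\<Sum>k=1..n. 1 / real k) \<le> 1 + ln (real n)"
  using euler_mascheroni_sequence_decreasing[of 1 n] by (simp add: harm_def inverse_eq_divide)

context ucbid_auction
begin

theorem regret_bound:
  "\<exists>C. \<forall>T::nat. T \<ge> 2 \<longrightarrow>
     real T * U bs - (\<Sum>t=1..T. expectation (\<lambda>\<omega>. U (bid t \<omega>)))
     \<le> 12 * sqrt (\<gamma> / p) * sqrt (real T * ln (real T)) + C * ln (real T)"
proof -
  obtain K where K: "K \<ge> 0" "\<And>n. n \<ge> 1 \<Longrightarrow> U bs - expectation (\<lambda>\<omega>. U (bid (Suc n) \<omega>)) \<le>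
    6 * (sqrt (\<gamma> / p) * sqrt (ln (real n) / real n)) + K / real n + 8 * real n powr (1 - \<gamma>)"
    using expected_regret_le by blast
  define Z where "Z = (\<Sum>n. real n powr (1 - \<gamma>))"
  have Z0: "Z \<ge> 0" unfolding Z_def by (intro suminf_nonneg bad_summable) auto
  \<comment> \<open>Contributions bounded independently of \<open>T\<close> are charged to the
    logarithm through \<open>ln T \<ge> ln 2\<close>.\<close>
  define C where "C = K + (2 + K + 8 * Z) / ln 2"
  show ?thesis
  proof (intro exI[of _ C] allI impI)
    fix T :: nat assume T: "T \<ge> 2"
    let ?g = "sqrt (\<gamma> / p)"
    define N where "N = T - 1"
    have N: "T = Suc N" "N \<ge> 1" using T by (auto simp: N_def)
    have lnT: "ln (real T) \<ge> ln 2" using T by simp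
    have g0: "?g \<ge> 0" using gamma p_pos by simp
    have sq: "(\<Sum>n=1..N. ?g * sqrt (ln (real n) / real n)) \<le> 2 * ?g * sqrt (real T * ln (real T))"
    proof -
      have "(\<Sum>n=1..N. ?g * sqrt (ln (real n) / real n)) \<le> (\<Sum>n=1..N. ?g * (sqrt (ln (real T)) * (1 / sqrt (real n))))"
      proof (intro sum_mono mult_left_mono g0)
        fix n assume n: "n \<in> {1..N}"
        then have "sqrt (ln (real n)) \<le> sqrt (ln (real T))" using N by simp
        then show "sqrt (ln (real n) / real n) \<le> sqrt (ln (real T)) * (1 / sqrt (real n))"
          by (simp add: real_sqrt_divide divide_right_mono)
      qed
      also have "\<dots> = ?g * sqrt (ln (real T)) * (\<Sum>n=1..N. 1 / sqrt (real n))"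
        by (simp only: sum_distrib_left mult.assoc)
      also have "\<dots> \<le> ?g * sqrt (ln (real T)) * (2 * sqrt (real T))"
      proof (intro mult_left_mono)
        show "(\<Sum>n=1..N. 1 / sqrt (real n)) \<le> 2 * sqrt (real T)"
          using sum_inverse_sqrt_le[of N] N by (smt (verit) real_sqrt_le_mono of_nat_Suc)
        show "0 \<le> ?g * sqrt (ln (real T))" using g0 T by simp
      qed
      also have "\<dots> = 2 * ?g * sqrt (real T * ln (real T))" by (simp add: real_sqrt_mult)
      finally show ?thesis .
    qed
    have harmonic: "(\<Sum>n=1..N. K / real n) \<le> K * (1 + ln (real T))"
    proof -
      have "(\<Sum>n=1..N. K / real n) = K * (\<Sum>n=1..N. 1 / real n)" by (simp add: sum_distrib_left)
      also have "\<dots> \<le> K * (1 + ln (real N))" using N by (intro mult_left_mono sum_inverse_le_ln K) auto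
      also have "\<dots> \<le> K * (1 + ln (real T))" using N K(1) by (intro mult_left_mono) auto
      finally show ?thesis .
    qed
    have bad: "(\<Sum>n=1..N. 8 * real n powr (1 - \<gamma>)) \<le> 8 * Z"
      unfolding sum_distrib_left[symmetric] Z_def
      by (intro mult_left_mono sum_le_suminf bad_summable) auto
    have "real T * U bs - (\<Sum>t=1..T. expectation (\<lambda>\<omega>. U (bid t \<omega>))) =
        (\<Sum>t=1..T. U bs - expectation (\<lambda>\<omega>. U (bid t \<omega>)))"
      by (simp add: sum_subtractf)
    \<comment> \<open>The first round has no history and costs at most 2; round \<open>n + 1\<close>
      is matched with its \<open>n\<close> past observations.\<close>
    also have "\<dots> = (U bs - expectation (\<lambda>\<omega>. U (bid 1 \<omega>))) + (\<Sum>n=1..N. U bs - expectation (\<lambda>\<omega>. U (bid (Suc n) \<omega>)))"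
      unfolding N(1)
      by (subst sum.atLeast_Suc_atMost, simp, subst sum.shift_bounds_cl_Suc_ivl, rule refl)
    also have "\<dots> \<le> 2 + (\<Sum>n=1..N. 6 * (?g * sqrt (ln (real n) / real n)) + K / real n + 8 * real n powr (1 - \<gamma>))"
      using K(2) by (intro add_mono expected_regret_le_2 sum_mono) auto
    also have "\<dots> = 2 + 6 * (\<Sum>n=1..N. ?g * sqrt (ln (real n) / real n)) + (\<Sum>n=1..N. K / real n) + (\<Sum>n=1..N. 8 * real n powr (1 - \<gamma>))"
      by (simp add: sum.distrib sum_distrib_left)
    \<comment> \<open>The constant 12 is the per-round factor 6 times the 2 from summing inverse
      square roots.\<close>
    also have "\<dots> \<le> 2 + 6 * (2 * ?g * sqrt (real T * ln (real T))) + K * (1 + ln (real T)) + 8 * Z"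
      using sq harmonic bad by linarith
    also have "\<dots> = 12 * ?g * sqrt (real T * ln (real T)) + K * ln (real T) + (2 + K + 8 * Z) * 1"
      by (simp add: algebra_simps)
    also have "\<dots> \<le> 12 * ?g * sqrt (real T * ln (real T)) + K * ln (real T) + (2 + K + 8 * Z) * (ln (real T) / ln 2)"
      using lnT K(1) Z0 by (intro add_left_mono mult_left_mono) auto
    also have "\<dots> = 12 * ?g * sqrt (real T * ln (real T)) + C * ln (real T)"
      by (simp add: C_def algebra_simps add_divide_distrib)
    finally show "real T * U bs - (\<Sum>t=1..T. expectation (\<lambda>\<omega>. U (bid t \<omega>)))
      \<le> 12 * ?g * sqrt (real T * ln (real T)) + C * ln (real T)" .
  qed
qed

end

theorem theorem5:
  fixes P :: "'a measure" and V M :: "nat \<Rightarrow> 'a \<Rightarrow> real" and \<gamma> :: real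
  assumes "prob_space P"
    and "\<And>t. t \<ge> 1 \<Longrightarrow> V t \<in> borel_measurable P"
    and "\<And>t. t \<ge> 1 \<Longrightarrow> M t \<in> borel_measurable P"
    and "\<And>t \<omega>. t \<ge> 1 \<Longrightarrow> \<omega> \<in> space P \<Longrightarrow> V t \<omega> \<in> {0..1}"
    and "\<And>t \<omega>. t \<ge> 1 \<Longrightarrow> \<omega> \<in> space P \<Longrightarrow> M t \<omega> \<in> {0..1}"
    and "\<And>t. t \<ge> 1 \<Longrightarrow> distr P borel (V t) = distr P borel (V 1)"
    and "\<And>t. t \<ge> 1 \<Longrightarrow> distr P borel (M t) = distr P borel (M 1)"
    and "prob_space.indep_vars P (\<lambda>_. borel) (case_sum V M) ({1..} <+> {1..})"
    and "\<gamma> > 2"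
    and "F = (\<lambda>b. measure P {\<omega> \<in> space P. M 1 \<omega> \<le> b})"
    and "v = prob_space.expectation P (V 1)"
    and "F (bstar v F) > 0"
    and "util v F (bstar v F) > 0"
  shows "\<exists>C. \<forall>T::nat. T \<ge> 2 \<longrightarrow>
           real T * (SUP b\<in>{0..1}. util v F b)
             - (\<Sum>t=1..T. prob_space.expectation P (\<lambda>\<omega>. util v F (ucbid \<gamma> (\<lambda>s. V s \<omega>) (\<lambda>s. M s \<omega>) t)))
           \<le> 12 * sqrt (\<gamma> * v / util v F (bstar v F)) * sqrt (real T * ln (real T)) + C * ln (real T)"
proof -
  interpret ucbid_auction P V M \<gamma> v F
    using assms by (intro ucbid_auction.intro ucbid_auction_axioms.intro)
  have "(SUP b\<in>{0..1}. util v F b) = util v F (bstar v F)"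
    using bstar01 bstar_max by (intro cSup_eq_maximum) auto
  moreover have "\<gamma> / p = \<gamma> * v / util v F (bstar v F)" by (simp add: p_def)
  ultimately show ?thesis using regret_bound by (simp only: bid_def)
qed

end
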